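(* Let $T:\mathbb{N}\to\mathbb{R}^+$ be a manageable function such that the function $n\mapsto \frac{n\log n}{T(n)}$ computably converges to $\infty$. Then there is an algorithm that, given a one-tape Turing machine $M$, decides whether $M$ runs in time $T(n)$.
   Context: $\mathbb{N}=\{0,1,2,\dots\}$, $\mathbb{R}^+$ is the set of positive reals, $\mathbb{R}_{\ge 0}$ the non-negative reals; $\log$ is base $2$. Turing machines are deterministic. A one-tape Turing machine has a single both-way infinite read-write tape which also holds the input, and its head moves (left or right) at every step. A Turing machine $M$ runs in time $T(n)$ if for every $n\in\mathbb{N}$, $M$ makes at most $T(n)$ steps on every input of length $n$. A function $f:\mathbb{N}\to\mathbb{R}_{\ge0}$ is manageable if there is an algorithm which, given any $k$, positive integers $A_0,A_1,\dots,A_k$ and non-negative integers $B_0,B_1,\dots,B_k$, decides whether $f(A_0+x_1A_1+\dots+x_kA_k)<B_0+x_1B_1+\dots+x_kB_k$ holds for some $x_1,\dots,x_k\in\mathbb{N}$. A function $f:\mathbb{N}\to\mathbb{R}_{\ge0}$ computably converges to $\infty$ if there is a computable map $K\mapsto n_K$ ($K\in\mathbb{N}$) such that $f(n)\ge K$ for all $n\ge n_K$. *)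

theory Defs
  imports Complex_Main "HOL-Library.Nat_Bijection"
begin

section \<open>Algorithms\<close>

text \<open>
  Algorithms are modelled by the (total) general recursive functions: \<open>recursive n f\<close> says that
  \<open>f\<close>, restricted to argument lists of length \<open>n\<close>, is an \<open>n\<close>-ary recursive function.
  Minimisation is only applied to regular functions, so partial functions never occur; by
  Kleene's normal form theorem the resulting functions are exactly the total functions that are
  partial recursive, i.e. Turing computable.  Values on lists of length other than \<open>n\<close> are
  meaningless.
\<close>

inductive recursive :: "nat \<Rightarrow> (nat list \<Rightarrow> nat) \<Rightarrow> bool" where
  zero: "recursive n (\<lambda>xs. 0)"
| succ: "recursive 1 (\<lambda>xs. Suc (xs ! 0))"
| proj: "i < n \<Longrightarrow> recursive n (\<lambda>xs. xs ! i)"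
| comp: "recursive (length gs) f \<Longrightarrow> (\<forall>g\<in>set gs. recursive n g) \<Longrightarrow>
         recursive n (\<lambda>xs. f (map (\<lambda>g. g xs) gs))"
| prim: "recursive n f \<Longrightarrow> recursive (n + 2) g \<Longrightarrow>
         recursive (n + 1) (\<lambda>xs. rec_nat (f (tl xs)) (\<lambda>y r. g (y # r # tl xs)) (hd xs))"
| mini: "recursive (n + 1) f \<Longrightarrow> (\<forall>xs. length xs = n \<longrightarrow> (\<exists>y. f (y # xs) = 0)) \<Longrightarrow>
         recursive n (\<lambda>xs. LEAST y. f (y # xs) = 0)"

definition computable :: "(nat \<Rightarrow> nat) \<Rightarrow> bool" where
  "computable h \<longleftrightarrow> (\<exists>f. recursive 1 f \<and> (\<forall>x. f [x] = h x))"

text \<open>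
  There is an algorithm that, given an instance \<open>x \<in> D\<close> in the encoding \<open>enc\<close>, decides whether
  \<open>P x\<close> holds.  The output of the algorithm on codes of objects outside \<open>D\<close> is unspecified.
\<close>

definition decidable_on :: "('a \<Rightarrow> nat) \<Rightarrow> 'a set \<Rightarrow> ('a \<Rightarrow> bool) \<Rightarrow> bool" where
  "decidable_on enc D P \<longleftrightarrow>
     (\<exists>h. computable h \<and> (\<forall>x\<in>D. h (enc x) = (if P x then 1 else 0)))"


section \<open>Manageable functions and computable convergence\<close>

text \<open>
  An instance is a pair of lists \<open>A = [A\<^sub>0, \<dots>, A\<^sub>k]\<close> and \<open>B = [B\<^sub>0, \<dots>, B\<^sub>k]\<close>; \<open>k \<ge> 0\<close> is
  given implicitly through the common length.
\<close>

definition manageable_instances :: "(nat list \<times> nat list) set" where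
  "manageable_instances =
     {(A, B). length A = length B \<and> A \<noteq> [] \<and> (\<forall>a\<in>set A. a > 0)}"

definition lists_encode :: "nat list \<times> nat list \<Rightarrow> nat" where
  "lists_encode = (\<lambda>(A, B). prod_encode (list_encode A, list_encode B))"

definition affine :: "nat list \<Rightarrow> (nat \<Rightarrow> nat) \<Rightarrow> nat" where
  "affine A x = A ! 0 + (\<Sum>i\<in>{1..<length A}. x i * A ! i)"

definition manageable :: "(nat \<Rightarrow> real) \<Rightarrow> bool" where
  "manageable f \<longleftrightarrow>
     decidable_on lists_encode manageable_instances
       (\<lambda>(A, B). \<exists>x. f (affine A x) < real (affine B x))"

definition computably_converges_to_infinity :: "(nat \<Rightarrow> real) \<Rightarrow> bool" where
  "computably_converges_to_infinity f \<longleftrightarrow>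
     (\<exists>N. computable N \<and> (\<forall>K. \<forall>n\<ge>N K. f n \<ge> real K))"


section \<open>One-tape Turing machines\<close>

datatype move = Left | Right

text \<open>
  So that machines are finite objects that can be given to an algorithm, the states are
  \<open>{..<num_states M}\<close> and the tape symbols are \<open>{..<num_symbols M}\<close>; every machine has this form
  up to renaming.  The transition function is only relevant on non-halting states and tape symbols.
\<close>

record tm =
  num_states :: nat
  num_symbols :: nat
  input_alphabet :: "nat set"
  blank :: nat
  trans :: "nat \<Rightarrow> nat \<Rightarrow> nat \<times> nat \<times> move"
  start :: nat
  accept :: nat
  reject :: nat

definition halting :: "tm \<Rightarrow> nat \<Rightarrow> bool" where
  "halting M q \<longleftrightarrow> q = accept M \<or> q = reject M"

definition one_tape_tm :: "tm \<Rightarrow> bool" where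
  "one_tape_tm M \<longleftrightarrow>
     start M < num_states M \<and> accept M < num_states M \<and> reject M < num_states M \<and>
     accept M \<noteq> reject M \<and>
     blank M < num_symbols M \<and>
     input_alphabet M \<noteq> {} \<and> input_alphabet M \<subseteq> {..<num_symbols M} - {blank M} \<and>
     (\<forall>q<num_states M. \<forall>a<num_symbols M. \<not> halting M q \<longrightarrow>
        (case trans M q a of (q', b, d) \<Rightarrow> q' < num_states M \<and> b < num_symbols M))"

text \<open>A configuration consists of the state, the both-way infinite tape and the head position.\<close>

type_synonym config = "nat \<times> (int \<Rightarrow> nat) \<times> int"

fun shift :: "move \<Rightarrow> int" where
  "shift Left = -1"
| "shift Right = 1"

definition initial :: "tm \<Rightarrow> nat list \<Rightarrow> config" where
  "initial M w =
     (start M, (\<lambda>i. if 0 \<le> i \<and> i < int (length w) then w ! nat i else blank M), 0)"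

definition step :: "tm \<Rightarrow> config \<Rightarrow> config \<Rightarrow> bool" where
  "step M = (\<lambda>(q, tape, i) c'.
     \<not> halting M q \<and>
     (case trans M q (tape i) of (q', b, d) \<Rightarrow> c' = (q', tape(i := b), i + shift d)))"

text \<open>
  No computation on an input of length \<open>n\<close> has more than \<open>T n\<close> steps; since a non-halting
  configuration always has a successor, this includes that \<open>M\<close> halts on every input.
\<close>

definition runs_in_time :: "tm \<Rightarrow> (nat \<Rightarrow> real) \<Rightarrow> bool" where
  "runs_in_time M T \<longleftrightarrow>
     (\<forall>n w. w \<in> lists (input_alphabet M) \<longrightarrow> length w = n \<longrightarrow>
        (\<forall>s c. (step M ^^ s) (initial M w) c \<longrightarrow> real s \<le> T n))"

fun move_encode :: "move \<Rightarrow> nat" where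
  "move_encode Left = 0"
| "move_encode Right = 1"

text \<open>
  The transition function is given by its table in row-major order: the entry for state \<open>q\<close> and
  symbol \<open>a\<close> has index \<open>q * num_symbols M + a\<close>.  The rows of the halting states are present
  but carry no information.
\<close>

definition trans_table :: "tm \<Rightarrow> nat list" where
  "trans_table M =
     concat (map (\<lambda>q. map (\<lambda>a. case trans M q a of (q', b, d) \<Rightarrow>
         prod_encode (q', prod_encode (b, move_encode d))) [0..<num_symbols M])
       [0..<num_states M])"

definition tm_encode :: "tm \<Rightarrow> nat" where
  "tm_encode M = list_encode
     [num_states M, num_symbols M, set_encode (input_alphabet M), blank M,
      list_encode (trans_table M), start M, accept M, reject M]"

end

theory Submission
  imports Defs
begin

text \<open>
  Both alternatives have finite witnesses, which are searched for in parallel.  A violation of the time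
  bound is witnessed by a word and a number of steps.  For the other alternative, cutting out the
  part of a shortest word between two boundaries with the same crossing sequence shows that a machine
  running in time \<open>o(n log n)\<close> has crossing sequences of bounded length \<open>c\<close>.  Given \<open>c\<close>, every run
  reduces to a run on a word of bounded length by cutting out short parts whose removal loses no
  crossing sequence, so that the removed parts can be put back in any order and number.  Hence the
  pairs of word length and running time form finitely many linear sets, whose base points and periods are
  found by simulating the machine on short words, and manageability compares each of them with \<open>T\<close>.

  All of this is done with truncated runs and the crossing sequences up to the moment of truncation, so that
  halting plays no special role.
\<close>

section \<open>Closure properties of the recursive functions\<close>

text \<open>Why n log n: over q states there are only about \<open>q^l\<close> crossing sequences of
  length at most l, so n/2 pairwise different ones have average length of order log n. Different
  boundaries are crossed in different steps, so the total of these lengths is a lower bound on the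
  time.

  The obstacle is that boundedness of the crossing sequences quantifies over all words. The bound c
  is therefore guessed, and a guess can be checked because short words suffice. When a run first
  exceeds c, its sequences have length at most c + 1, so few of them are different, and a long word
  can be shortened without losing the offending one.

  Truncated runs are legitimate since the time bound speaks of every number of steps that is
  reached: a diverging run just contributes arbitrarily large numbers of steps for one length.

  Both searches are performed by one minimisation, which has to succeed on every input. This is why
  each list of numbers is read as a machine and the alternative is proved for all of them.\<close>

definition rc :: "nat \<Rightarrow> (nat list \<Rightarrow> nat) \<Rightarrow> bool" where
  "rc n F \<longleftrightarrow> (\<exists>f. recursive n f \<and> (\<forall>xs. length xs = n \<longrightarrow> f xs = F xs))"

text \<open>Values of recursive functions on lists of the wrong length are arbitrary. Since
  \<open>rc\<close> ignores them, the function in it may be rewritten freely.\<close>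

lemma rc_cong: "rc n F \<Longrightarrow> (\<And>xs. length xs = n \<Longrightarrow> F xs = G xs) \<Longrightarrow> rc n G"
  unfolding rc_def by metis

lemma rc_proj: "i < n \<Longrightarrow> rc n (\<lambda>xs. xs ! i)"
  unfolding rc_def using recursive.proj by blast

lemma rc_comp:
  assumes "rc (length Gs) F" "\<forall>G\<in>set Gs. rc n G"
  shows "rc n (\<lambda>xs. F (map (\<lambda>g. g xs) Gs))"
proof -
  obtain f where f: "recursive (length Gs) f" "\<And>xs. length xs = length Gs \<Longrightarrow> f xs = F xs"
    using assms(1) unfolding rc_def by blast
  obtain sel where sel: "\<forall>G\<in>set Gs. recursive n (sel G) \<and> (\<forall>xs. length xs = n \<longrightarrow> sel G xs = G xs)"
    using bchoice[OF assms(2)[unfolded rc_def]] by blast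
  have "recursive n (\<lambda>xs. f (map (\<lambda>g. g xs) (map sel Gs)))"
    by (rule recursive.comp) (use f sel in auto)
  moreover have "f (map (\<lambda>g. g xs) (map sel Gs)) = F (map (\<lambda>g. g xs) Gs)" if "length xs = n" for xs
  proof -
    have "map (\<lambda>g. g xs) (map sel Gs) = map (\<lambda>g. g xs) Gs"
      using sel that by auto
    then show ?thesis using f(2)[of "map (\<lambda>g. g xs) Gs"] by (simp only: length_map)
  qed
  ultimately show ?thesis unfolding rc_def by blast
qed

lemma rc_comp1: "rc 1 (\<lambda>xs. h (xs ! 0)) \<Longrightarrow> rc n F \<Longrightarrow> rc n (\<lambda>xs. h (F xs))"
  using rc_comp[of "[F]" "\<lambda>xs. h (xs ! 0)" n] by simp

lemma rc_comp2:
  "rc 2 (\<lambda>xs. h (xs ! 0) (xs ! 1)) \<Longrightarrow> rc n F \<Longrightarrow> rc n G \<Longrightarrow> rc n (\<lambda>xs. h (F xs) (G xs))"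
  using rc_comp[of "[F, G]" "\<lambda>xs. h (xs ! 0) (xs ! 1)" n] by (simp add: numeral_2_eq_2)

lemma rc_Suc: "rc n F \<Longrightarrow> rc n (\<lambda>xs. Suc (F xs))"
proof -
  have "rc 1 (\<lambda>xs. Suc (xs ! 0))" unfolding rc_def using recursive.succ by blast
  then show "rc n F \<Longrightarrow> rc n (\<lambda>xs. Suc (F xs))" by (rule rc_comp1)
qed

lemma rc_const: "rc n (\<lambda>xs. c)"
proof (induction c)
  case 0 show ?case unfolding rc_def using recursive.zero by blast
next
  case (Suc c) then show ?case by (rule rc_Suc)
qed

lemma rc_prim:
  assumes "rc n f" "rc (n + 2) g"
  shows "rc (n + 1) (\<lambda>xs. rec_nat (f (tl xs)) (\<lambda>y r. g (y # r # tl xs)) (hd xs))"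
proof -
  obtain f' where f': "recursive n f'" "\<And>xs. length xs = n \<Longrightarrow> f' xs = f xs"
    using assms(1) unfolding rc_def by blast
  obtain g' where g': "recursive (n + 2) g'" "\<And>xs. length xs = n + 2 \<Longrightarrow> g' xs = g xs"
    using assms(2) unfolding rc_def by blast
  have "rec_nat (f' (tl xs)) (\<lambda>y r. g' (y # r # tl xs)) k = rec_nat (f (tl xs)) (\<lambda>y r. g (y # r # tl xs)) k"
    if "length xs = n + 1" for xs k
    using that by (induction k) (auto simp: f'(2) g'(2))
  then show ?thesis
    unfolding rc_def using recursive.prim[OF f'(1) g'(1)] by blast
qed

text \<open>Brings the counter from the front of the argument list, where \<open>prim\<close> has
  it, to the place behind the parameter.\<close>

lemma rc_rec2:
  assumes "rc 1 (\<lambda>xs. a (xs ! 0))" "rc 3 (\<lambda>xs. g (xs ! 2) (xs ! 0) (xs ! 1))"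
  shows "rc 2 (\<lambda>xs. rec_nat (a (xs ! 0)) (\<lambda>y r. g (xs ! 0) y r) (xs ! 1))"
proof -
  have "rc (1 + 1) (\<lambda>xs. rec_nat (a (tl xs ! 0)) (\<lambda>y r. g ((y # r # tl xs) ! 2) ((y # r # tl xs) ! 0) ((y # r # tl xs) ! 1)) (hd xs))"
    by (rule rc_prim) (use assms in \<open>simp_all add: numeral_3_eq_3 numeral_2_eq_2\<close>)
  then have "rc 2 (\<lambda>xs. rec_nat (a (xs ! 1)) (\<lambda>y r. g (xs ! 1) y r) (xs ! 0))"
    unfolding one_add_one by (rule rc_cong) (auto simp: length_Suc_conv numeral_2_eq_2)
  from rc_comp2[where h = "\<lambda>k x. rec_nat (a x) (\<lambda>y r. g x y r) k", OF this rc_proj[of 1] rc_proj[of 0]]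
  show ?thesis by simp
qed

lemma rc_mini:
  assumes "rc 2 (\<lambda>xs. F (xs ! 0) (xs ! 1))" "\<And>x. \<exists>y. F y x = 0"
  shows "rc 1 (\<lambda>xs. LEAST y. F y (xs ! 0) = 0)"
proof -
  obtain f where f: "recursive 2 f" "\<And>xs. length xs = 2 \<Longrightarrow> f xs = F (xs ! 0) (xs ! 1)"
    using assms(1) unfolding rc_def by blast
  have eq: "f (y # xs) = F y (xs ! 0)" if "length xs = 1" for y xs
    using that by (simp add: f(2))
  have "recursive 1 (\<lambda>xs. LEAST y. f (y # xs) = 0)"
  proof (rule recursive.mini)
    show "recursive (1 + 1) f" using f(1) by (simp only: one_add_one)
    show "\<forall>xs. length xs = 1 \<longrightarrow> (\<exists>y. f (y # xs) = 0)" using assms(2) eq by simp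
  qed
  moreover have "(LEAST y. f (y # xs) = 0) = (LEAST y. F y (xs ! 0) = 0)" if "length xs = 1" for xs
    using eq[OF that] by simp
  ultimately show ?thesis unfolding rc_def by blast
qed

section \<open>Arithmetic of recursive functions\<close>

lemma rc_add: "rc n F \<Longrightarrow> rc n G \<Longrightarrow> rc n (\<lambda>xs. F xs + G xs)"
proof -
  have eq: "rec_nat x (\<lambda>_ r. Suc r) k = x + k" for x k by (induction k) auto
  have "rc 2 (\<lambda>xs. rec_nat (xs ! 0) (\<lambda>_ r. Suc r) (xs ! 1))"
    by (rule rc_rec2) (auto intro!: rc_Suc rc_proj)
  then show "rc n F \<Longrightarrow> rc n G \<Longrightarrow> rc n (\<lambda>xs. F xs + G xs)"
    unfolding eq by (rule rc_comp2)
qed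

lemma rc_pred: "rc n F \<Longrightarrow> rc n (\<lambda>xs. F xs - 1)"
proof -
  have eq: "rec_nat 0 (\<lambda>y _. y) k = k - 1" for k by (cases k) auto
  have "rc 2 (\<lambda>xs. rec_nat 0 (\<lambda>y _. y) (xs ! 1))"
    by (rule rc_rec2) (auto intro!: rc_const rc_proj)
  from rc_comp2[where h = "\<lambda>x y. rec_nat 0 (\<lambda>y _. y) y", OF this]
  show "rc n F \<Longrightarrow> rc n (\<lambda>xs. F xs - 1)" unfolding eq by blast
qed

lemma rc_diff: "rc n F \<Longrightarrow> rc n G \<Longrightarrow> rc n (\<lambda>xs. F xs - G xs)"
proof -
  have eq: "rec_nat x (\<lambda>_ r. r - 1) k = x - k" for x k :: nat by (induction k) auto
  have "rc 2 (\<lambda>xs. rec_nat (xs ! 0) (\<lambda>_ r. r - 1) (xs ! 1))"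
    by (rule rc_rec2; intro rc_pred rc_proj; simp)
  then show "rc n F \<Longrightarrow> rc n G \<Longrightarrow> rc n (\<lambda>xs. F xs - G xs)"
    unfolding eq by (rule rc_comp2)
qed

lemma rc_mult: "rc n F \<Longrightarrow> rc n G \<Longrightarrow> rc n (\<lambda>xs. F xs * G xs)"
proof -
  have eq: "rec_nat 0 (\<lambda>_ r. r + x) k = x * k" for x k :: nat by (induction k) auto
  have "rc 2 (\<lambda>xs. rec_nat 0 (\<lambda>_ r. r + xs ! 0) (xs ! 1))"
    by (rule rc_rec2) (auto intro!: rc_add rc_proj rc_const)
  then show "rc n F \<Longrightarrow> rc n G \<Longrightarrow> rc n (\<lambda>xs. F xs * G xs)"
    unfolding eq by (rule rc_comp2)
qed

lemma rc_triangle: "rc n F \<Longrightarrow> rc n (\<lambda>xs. triangle (F xs))"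
proof -
  have eq: "rec_nat 0 (\<lambda>y r. r + Suc y) k = triangle k" for k by (induction k) auto
  have "rc 2 (\<lambda>xs. rec_nat 0 (\<lambda>y r. r + Suc y) (xs ! 1))"
    by (rule rc_rec2) (auto intro!: rc_add rc_Suc rc_proj rc_const)
  from rc_comp2[where h = "\<lambda>x y. rec_nat 0 (\<lambda>y r. r + Suc y) y", OF this]
  show "rc n F \<Longrightarrow> rc n (\<lambda>xs. triangle (F xs))" unfolding eq by blast
qed

lemma computable_rc: "computable h \<longleftrightarrow> rc 1 (\<lambda>xs. h (xs ! 0))"
proof
  assume "computable h"
  then obtain f where "recursive 1 f" "\<And>x. f [x] = h x" unfolding computable_def by blast
  then show "rc 1 (\<lambda>xs. h (xs ! 0))"
    unfolding rc_def by (intro exI[of _ f]) (auto simp: length_Suc_conv)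
qed (force simp: rc_def computable_def)

lemma computable_id: "computable (\<lambda>x. x)"
  unfolding computable_rc by (rule rc_proj) simp

lemma computable_const: "computable (\<lambda>x. c)"
  unfolding computable_rc by (rule rc_const)

lemma computable_compose: "computable g \<Longrightarrow> computable f \<Longrightarrow> computable (\<lambda>x. g (f x))"
  unfolding computable_rc by (rule rc_comp1)

lemma computable_add: "computable f \<Longrightarrow> computable g \<Longrightarrow> computable (\<lambda>x. f x + g x)"
  unfolding computable_rc by (rule rc_add)

lemma computable_diff: "computable f \<Longrightarrow> computable g \<Longrightarrow> computable (\<lambda>x. f x - g x)"
  unfolding computable_rc by (rule rc_diff)

lemma computable_mult: "computable f \<Longrightarrow> computable g \<Longrightarrow> computable (\<lambda>x. f x * g x)"
  unfolding computable_rc by (rule rc_mult)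

lemma computable_triangle: "computable f \<Longrightarrow> computable (\<lambda>x. triangle (f x))"
  unfolding computable_rc by (rule rc_triangle)

section \<open>Pairing and unpairing of numbers\<close>

lemma rc_prod_encode: "rc n F \<Longrightarrow> rc n G \<Longrightarrow> rc n (\<lambda>xs. prod_encode (F xs, G xs))"
  by (simp add: prod_encode_def rc_add rc_triangle)

lemma computable_prod_encode:
  "computable f \<Longrightarrow> computable g \<Longrightarrow> computable (\<lambda>x. prod_encode (f x, g x))"
  unfolding computable_rc by (rule rc_prod_encode)

text \<open>Since \<open>prod_encode (a, b)\<close> is \<open>triangle (a + b) + a\<close>, the sum
  a + b is the least r with \<open>n < triangle (Suc r)\<close>. Truncated subtraction turns this
  inequality into the equation with 0 that minimisation works on.\<close>

definition diagonal :: "nat \<Rightarrow> nat" where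
  "diagonal n = (LEAST r. Suc n - triangle (Suc r) = 0)"

lemma triangle_mono: "m \<le> n \<Longrightarrow> triangle m \<le> triangle n"
  by (induction rule: dec_induct) auto

lemma diagonal_prod_encode: "diagonal (prod_encode (a, b)) = a + b"
  unfolding diagonal_def
proof (rule Least_equality)
  show "Suc (prod_encode (a, b)) - triangle (Suc (a + b)) = 0"
    by (simp add: prod_encode_def)
  fix r assume "Suc (prod_encode (a, b)) - triangle (Suc r) = 0"
  then have less: "triangle (a + b) + a < triangle (Suc r)"
    by (simp add: prod_encode_def del: triangle_Suc)
  show "a + b \<le> r"
  proof (rule ccontr)
    assume "\<not> a + b \<le> r"
    then have "triangle (Suc r) \<le> triangle (a + b)" by (intro triangle_mono) simp
    then show False using less by simp
  qed
qed

lemma computable_diagonal: "computable diagonal"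
  unfolding computable_rc diagonal_def
proof (rule rc_mini)
  show "rc 2 (\<lambda>xs. Suc (xs ! 1) - triangle (Suc (xs ! 0)))"
    by (intro rc_diff rc_Suc rc_triangle rc_proj) auto
  have "x \<le> triangle x" for x by (induction x) auto
  then have "Suc x - triangle (Suc x) = 0" for x by (simp add: trans_le_add2)
  then show "\<exists>y. Suc x - triangle (Suc y) = 0" for x by blast
qed

lemma prod_decode_diagonal:
  "fst (prod_decode n) = n - triangle (diagonal n)"
  "snd (prod_decode n) = diagonal n - (n - triangle (diagonal n))"
proof -
  obtain a b where n: "n = prod_encode (a, b)" by (metis prod_decode_inverse surj_pair)
  show "fst (prod_decode n) = n - triangle (diagonal n)"
    "snd (prod_decode n) = diagonal n - (n - triangle (diagonal n))"
    by (simp_all add: n diagonal_prod_encode) (simp_all add: prod_encode_def)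
qed

lemma computable_prod_decode:
  assumes "computable f"
  shows "computable (\<lambda>x. fst (prod_decode (f x)))" "computable (\<lambda>x. snd (prod_decode (f x)))"
proof -
  note d = computable_compose[OF computable_diagonal assms]
  show "computable (\<lambda>x. fst (prod_decode (f x)))"
    unfolding prod_decode_diagonal by (intro computable_diff computable_triangle assms d)
  show "computable (\<lambda>x. snd (prod_decode (f x)))"
    unfolding prod_decode_diagonal by (intro computable_diff computable_triangle assms d)
qed

text \<open>Parameter, counter and accumulator of the step are packed into one number, so that
  recursion stays within unary functions.\<close>

lemma computable_rec_nat:
  assumes a: "computable a" and n: "computable n"
    and g: "computable (\<lambda>p. g (fst (prod_decode p)) (fst (prod_decode (snd (prod_decode p))))
      (snd (prod_decode (snd (prod_decode p)))))"
  shows "computable (\<lambda>x. rec_nat (a x) (g x) (n x))"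
proof -
  have p: "rc 3 (\<lambda>xs. prod_encode (xs ! 2, prod_encode (xs ! 0, xs ! 1)))"
    by (intro rc_prod_encode rc_proj) auto
  have "rc 3 (\<lambda>xs. g (xs ! 2) (xs ! 0) (xs ! 1))"
    using rc_comp1[OF g[unfolded computable_rc] p] by simp
  with a have "rc 2 (\<lambda>xs. rec_nat (a (xs ! 0)) (\<lambda>y r. g (xs ! 0) y r) (xs ! 1))"
    unfolding computable_rc by (rule rc_rec2)
  from rc_comp2[where h = "\<lambda>x k. rec_nat (a x) (\<lambda>y r. g x y r) k", OF this, where n = 1]
  show ?thesis using n unfolding computable_rc by (simp add: rc_proj)
qed

lemma computable_Least:
  assumes F: "computable (\<lambda>p. F (fst (prod_decode p)) (snd (prod_decode p)))" and ex: "\<And>x. \<exists>y. F x y = 0"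
  shows "computable (\<lambda>x. LEAST y. F x y = 0)"
  unfolding computable_rc
proof (rule rc_mini)
  have "rc 2 (\<lambda>xs. prod_encode (xs ! 1, xs ! 0))" by (intro rc_prod_encode rc_proj) auto
  from rc_comp1[OF F[unfolded computable_rc] this]
  show "rc 2 (\<lambda>xs. F (xs ! 1) (xs ! 0))" by simp
qed (rule ex)


section \<open>Effective functions on encoded types\<close>

text \<open>A bijection rather than an injection: every number is a code, so decoding never has to
  check validity.\<close>

class encodable =
  fixes code :: "'a \<Rightarrow> nat"
  assumes bij_code: "bij code"
begin

definition decode :: "nat \<Rightarrow> 'a" where "decode = inv code"

lemma decode_code [simp]: "decode (code x) = x"
  unfolding decode_def using bij_code by (simp add: bij_is_inj)

lemma code_decode [simp]: "code (decode n) = n"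
  unfolding decode_def using bij_code by (simp add: bij_is_surj surj_f_inv_f)

lemma code_inject [simp]: "code x = code y \<longleftrightarrow> x = y"
  by (metis decode_code)

end

instantiation nat :: encodable
begin
definition "code_nat = (\<lambda>n :: nat. n)"
instance by standard (simp add: code_nat_def bij_def)
end

instantiation int :: encodable
begin
definition "code_int = int_encode"
instance by standard (simp add: code_int_def bij_int_encode)
end

instantiation prod :: (encodable, encodable) encodable
begin
definition "code_prod = (\<lambda>(x :: 'a, y :: 'b). prod_encode (code x, code y))"
instance
proof
  have "(\<lambda>(x :: 'a, y :: 'b). prod_encode (code x, code y)) = prod_encode \<circ> map_prod code code"
    by (auto simp: fun_eq_iff)
  moreover have "bij (prod_encode \<circ> map_prod (code :: 'a \<Rightarrow> nat) (code :: 'b \<Rightarrow> nat))"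
    by (intro bij_comp bij_prod_encode) (metis bij_betw_map_prod bij_code UNIV_Times_UNIV)
  ultimately show "bij (code :: 'a \<times> 'b \<Rightarrow> nat)" by (simp add: code_prod_def)
qed
end

instantiation list :: (encodable) encodable
begin
definition "code_list xs = list_encode (map code (xs :: 'a list))"
instance
proof
  have "bij (map (code :: 'a \<Rightarrow> nat))"
    using bij_code[where 'a = 'a] by (simp add: bij_def surj_def inj_map) (metis code_decode ex_map_conv)
  from bij_comp[OF this bij_list_encode] show "bij (code :: 'a list \<Rightarrow> nat)"
    by (simp add: code_list_def[abs_def] comp_def)
qed
end

lemma code_nat [simp]: "code (n :: nat) = n" by (simp add: code_nat_def)
lemma decode_nat [simp]: "decode n = (n :: nat)" by (metis code_nat code_decode)
lemma code_pair [simp]: "code (x, y) = prod_encode (code x, code y)" by (simp add: code_prod_def)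
lemma code_Nil [simp]: "code [] = 0" by (simp add: code_list_def)
lemma code_Cons [simp]: "code (x # xs) = Suc (prod_encode (code x, code xs))" by (simp add: code_list_def)
lemma code_nat_list: "code (xs :: nat list) = list_encode xs" by (simp add: code_list_def code_nat_def)

definition eff :: "('a :: encodable \<Rightarrow> 'b :: encodable) \<Rightarrow> bool" where
  "eff f \<longleftrightarrow> computable (\<lambda>n. code (f (decode n)))"

named_theorems eff_intros

lemma decode_pair: "decode p = (decode (fst (prod_decode p)), decode (snd (prod_decode p)))"
proof -
  obtain a b where "p = prod_encode (a, b)" by (metis prod_decode_inverse surj_pair)
  moreover have "decode (prod_encode (a, b)) = (decode a, decode b)"
    using decode_code[of "(decode a, decode b)"] by simp
  ultimately show ?thesis by simp
qed

lemma eff_id [eff_intros]: "eff (\<lambda>x. x)"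
  by (simp add: eff_def computable_id)

lemma eff_const [eff_intros]: "eff (\<lambda>x. c)"
  by (simp add: eff_def computable_const)

lemma eff_compose: "eff g \<Longrightarrow> eff f \<Longrightarrow> eff (\<lambda>x. g (f x))"
  unfolding eff_def using computable_compose[of "\<lambda>n. code (g (decode n))" "\<lambda>n. code (f (decode n))"] by simp

lemma eff_computable: "computable h \<Longrightarrow> eff f \<Longrightarrow> eff (\<lambda>x. h (f x))"
  unfolding eff_def using computable_compose[of h "\<lambda>n. code (f (decode n))"] by simp

lemma eff_Pair [eff_intros]: "eff f \<Longrightarrow> eff g \<Longrightarrow> eff (\<lambda>x. (f x, g x))"
  unfolding eff_def by (simp add: computable_prod_encode)

lemma code_fst: "code (fst p) = fst (prod_decode (code p))"
  and code_snd: "code (snd p) = snd (prod_decode (code p))"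
  by (cases p; simp)+

lemma eff_fst [eff_intros]: "eff f \<Longrightarrow> eff (\<lambda>x. fst (f x))"
  unfolding eff_def code_fst by (rule computable_prod_decode)

lemma eff_snd [eff_intros]: "eff f \<Longrightarrow> eff (\<lambda>x. snd (f x))"
  unfolding eff_def code_snd by (rule computable_prod_decode)

text \<open>The pattern for all binders: the body is made a function of a pair, with the outer
  context as \<open>fst p\<close> and the bound variable as \<open>snd p\<close>. Facts about the
  outer context are carried under the binder by \<open>eff_compose\<close> with a
  projection.\<close>

lemma eff_Let [eff_intros]:
  assumes "eff (\<lambda>p. g (fst p) (snd p))" "eff f"
  shows "eff (\<lambda>x. let y = f x in g x y)"
  using eff_compose[OF assms(1) eff_Pair[OF eff_id assms(2)]] by (simp add: Let_def)

lemma eff_code: "eff f \<Longrightarrow> eff (\<lambda>x. code (f x))"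
  by (simp add: eff_def)

lemma eff_decode: "eff f \<Longrightarrow> eff (\<lambda>x. decode (f x))"
  by (simp add: eff_def)

text \<open>Covers conversions that leave the code unchanged, such as the one between a pair and the
  number coding it.\<close>

lemma eff_same_code: "eff f \<Longrightarrow> (\<And>x. code (g x) = code (f x)) \<Longrightarrow> eff g"
  by (simp add: eff_def)

lemma eff_add [eff_intros]: "eff f \<Longrightarrow> eff g \<Longrightarrow> eff (\<lambda>x. f x + g x :: nat)"
  unfolding eff_def by (simp add: computable_add)

lemma eff_Suc [eff_intros]: "eff f \<Longrightarrow> eff (\<lambda>x. Suc (f x))"
  using eff_add[of f "\<lambda>_. 1"] by (simp add: eff_const)

lemma eff_diff [eff_intros]: "eff f \<Longrightarrow> eff g \<Longrightarrow> eff (\<lambda>x. f x - g x :: nat)"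
  unfolding eff_def by (simp add: computable_diff)

lemma eff_mult [eff_intros]: "eff f \<Longrightarrow> eff g \<Longrightarrow> eff (\<lambda>x. f x * g x :: nat)"
  unfolding eff_def by (simp add: computable_mult)

lemma eff_rec_nat [eff_intros]:
  fixes a :: "'a :: encodable \<Rightarrow> 'b :: encodable"
  assumes a: "eff a" and g: "eff (\<lambda>p. g (fst p) (fst (snd p)) (snd (snd p)))" and n: "eff n"
  shows "eff (\<lambda>x. rec_nat (a x) (\<lambda>y r. g x y r) (n x))"
proof -
  have eq: "code (rec_nat (a x) (g x) k) = rec_nat (code (a x)) (\<lambda>y r. code (g x y (decode r))) k" for x k
  proof (induction k)
    case (Suc k)
    show ?case by (simp flip: Suc)
  qed simp
  have "computable (\<lambda>p. code (g (decode (fst (prod_decode p))) (fst (prod_decode (snd (prod_decode p))))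
      (decode (snd (prod_decode (snd (prod_decode p)))))))"
    using g unfolding eff_def by (simp add: decode_pair)
  then show ?thesis
    using a n unfolding eff_def eq by (intro computable_rec_nat) auto
qed

lemma eff_power [eff_intros]:
  assumes "eff f" "eff g"
  shows "eff (\<lambda>x. f x ^ g x :: nat)"
proof -
  have "rec_nat 1 (\<lambda>_ r. r * a) n = a ^ n" for a n :: nat by (induction n) auto
  moreover have "eff (\<lambda>x. rec_nat 1 (\<lambda>_ r. r * f x) (g x))"
    by (intro eff_intros eff_compose[OF assms(1)] assms)
  ultimately show ?thesis by simp
qed

section \<open>Decidable predicates and bounded quantifiers\<close>

definition dec :: "('a :: encodable \<Rightarrow> bool) \<Rightarrow> bool" where
  "dec P \<longleftrightarrow> eff (\<lambda>x. of_bool (P x) :: nat)"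

text \<open>A case distinction is a recursion with no or one iteration whose step ignores its
  arguments.\<close>

lemma eff_if [eff_intros]:
  assumes "dec P" "eff f" "eff g"
  shows "eff (\<lambda>x. if P x then f x else g x)"
proof -
  have "eff (\<lambda>x. rec_nat (g x) (\<lambda>_ _. f x) (of_bool (P x)))"
    by (intro eff_intros eff_compose[OF assms(2)] assms(1)[unfolded dec_def] assms(3))
  moreover have "rec_nat (g x) (\<lambda>_ _. f x) (of_bool (P x)) = (if P x then f x else g x)" for x
    by simp
  ultimately show ?thesis by simp
qed

lemma dec_compose: "dec P \<Longrightarrow> eff f \<Longrightarrow> dec (\<lambda>x. P (f x))"
  unfolding dec_def by (rule eff_compose)

lemma dec_not [eff_intros]: "dec P \<Longrightarrow> dec (\<lambda>x. \<not> P x)"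
proof -
  have eq: "1 - of_bool b = (of_bool (\<not> b) :: nat)" for b by simp
  show "dec P \<Longrightarrow> dec (\<lambda>x. \<not> P x)"
    unfolding dec_def eq[symmetric] by (intro eff_diff eff_const)
qed

lemma dec_conj [eff_intros]: "dec P \<Longrightarrow> dec Q \<Longrightarrow> dec (\<lambda>x. P x \<and> Q x)"
  unfolding dec_def using eff_mult[of "\<lambda>x. of_bool (P x)" "\<lambda>x. of_bool (Q x)"] by (simp add: of_bool_conj)

lemma dec_disj [eff_intros]: "dec P \<Longrightarrow> dec Q \<Longrightarrow> dec (\<lambda>x. P x \<or> Q x)"
  using dec_not[OF dec_conj[OF dec_not dec_not], of P Q] by simp

lemma dec_imp [eff_intros]: "dec P \<Longrightarrow> dec Q \<Longrightarrow> dec (\<lambda>x. P x \<longrightarrow> Q x)"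
  unfolding imp_conv_disj by (intro dec_disj dec_not)

lemma dec_If [eff_intros]: "dec P \<Longrightarrow> dec Q \<Longrightarrow> dec R \<Longrightarrow> dec (\<lambda>x. if P x then Q x else R x)"
  unfolding if_bool_eq_conj by (intro dec_conj dec_imp dec_not)

lemma dec_le [eff_intros]:
  assumes "eff f" "eff g" shows "dec (\<lambda>x. f x \<le> (g x :: nat))"
proof -
  have "eff (\<lambda>x. 1 - (f x - g x))" by (intro eff_intros assms)
  moreover have "1 - (a - b) = of_bool (a \<le> b)" for a b :: nat by auto
  ultimately show ?thesis by (simp add: dec_def)
qed

lemma dec_less [eff_intros]: "eff f \<Longrightarrow> eff g \<Longrightarrow> dec (\<lambda>x. f x < (g x :: nat))"
  using dec_le[OF eff_Suc, of f g] by (simp add: Suc_le_eq)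

lemma dec_eq [eff_intros]: "eff f \<Longrightarrow> eff g \<Longrightarrow> dec (\<lambda>x. f x = g x)"
  using dec_conj[OF dec_le[OF eff_code eff_code] dec_le[OF eff_code eff_code], of f g g f]
  by (simp flip: eq_iff)

lemma dec_ex_less [eff_intros]:
  fixes P :: "'a :: encodable \<Rightarrow> nat \<Rightarrow> bool"
  assumes P: "dec (\<lambda>p. P (fst p) (snd p))" and n: "eff n"
  shows "dec (\<lambda>x. \<exists>y<n x. P x y)"
proof -
  have "eff (\<lambda>x. rec_nat 0 (\<lambda>y r. if P x y then 1 else r) (n x) :: nat)"
    by (intro eff_intros dec_compose[OF P, of "\<lambda>p. (fst p, fst (snd p))", simplified] n)
  moreover have "rec_nat 0 (\<lambda>y r. if P x y then 1 else r) k = (of_bool (\<exists>y<k. P x y) :: nat)" for x k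
    by (induction k) (auto simp: less_Suc_eq)
  ultimately show ?thesis by (simp add: dec_def)
qed

lemma dec_all_less [eff_intros]:
  fixes P :: "'a :: encodable \<Rightarrow> nat \<Rightarrow> bool"
  shows "dec (\<lambda>p. P (fst p) (snd p)) \<Longrightarrow> eff n \<Longrightarrow> dec (\<lambda>x. \<forall>y<n x. P x y)"
  using dec_not[OF dec_ex_less[OF dec_not, of P n]] by simp

lemma eff_Least:
  assumes P: "dec (\<lambda>p. P (fst p) (snd p))" and ex: "\<And>x. \<exists>y. P x y"
  shows "eff (\<lambda>x. LEAST y :: nat. P x y)"
proof -
  have "computable (\<lambda>p. of_bool (\<not> P (decode (fst (prod_decode p))) (snd (prod_decode p))))"
    using dec_not[OF P] unfolding dec_def eff_def by (simp add: decode_pair)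
  then have "computable (\<lambda>n. LEAST y. (of_bool (\<not> P (decode n) y) :: nat) = 0)"
    by (rule computable_Least) (use ex in simp)
  then show ?thesis by (simp add: eff_def)
qed

section \<open>Effective operations on lists and numbers\<close>

lemma eff_Cons [eff_intros]: "eff f \<Longrightarrow> eff g \<Longrightarrow> eff (\<lambda>x. f x # g x)"
  by (rule eff_same_code[OF eff_Suc[OF eff_code[OF eff_Pair]], of f g]) auto

lemma eff_case_list [eff_intros]:
  fixes l :: "'a :: encodable \<Rightarrow> 'b :: encodable list"
  assumes l: "eff l" and a: "eff a" and g: "eff (\<lambda>p. g (fst p) (fst (snd p)) (snd (snd p)))"
  shows "eff (\<lambda>x. case l x of [] \<Rightarrow> a x | y # ys \<Rightarrow> g x y ys)"
proof -
  \<comment> \<open>The code of a nonempty list is the successor of the code of the pair of head and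
    tail. On the empty list the value of h is arbitrary and discarded by the test.\<close>
  define h where "h = (\<lambda>x. decode (code (l x) - 1) :: 'b \<times> 'b list)"
  have h: "eff h" unfolding h_def by (intro eff_decode eff_code eff_diff eff_const l)
  have "eff (\<lambda>x. if code (l x) = 0 then a x else g x (fst (h x)) (snd (h x)))"
    by (intro eff_intros eff_code l a eff_compose[OF g, of "\<lambda>x. (x, h x)", simplified] h)
  moreover have "(if code (l x) = 0 then a x else g x (fst (h x)) (snd (h x)))
      = (case l x of [] \<Rightarrow> a x | y # ys \<Rightarrow> g x y ys)" for x
    by (cases "l x") (simp_all add: h_def flip: code_pair)
  ultimately show ?thesis by simp
qed

lemma length_le_code: "length xs \<le> code xs"
  by (induction xs) (auto intro: order_trans[OF _ le_prod_encode_2])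

text \<open>A fold is computed by iterating on pairs of accumulator and rest of the list; the code of the
  list is an upper bound on the number of iterations.\<close>

lemma eff_fold [eff_intros]:
  fixes l :: "'a :: encodable \<Rightarrow> 'b :: encodable list"
  assumes g: "eff (\<lambda>p. g (fst p) (fst (snd p)) (snd (snd p)))" and l: "eff l" and a: "eff a"
  shows "eff (\<lambda>x. fold (\<lambda>y r. g x y r) (l x) (a x))"
proof -
  define f where "f = (\<lambda>x p. case snd p of [] \<Rightarrow> p | y # ys \<Rightarrow> (g x y (fst p), ys))"
  have rec: "rec_nat b (\<lambda>_. f x) n = (f x ^^ n) b" for x n b
    by (induction n) auto
  have it: "(f x ^^ n) (b, ys) = (fold (g x) ys b, [])" if "length ys \<le> n" for x ys n b
    using that
  proof (induction ys arbitrary: n b)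
    case Nil then show ?case by (induction n) (auto simp: f_def)
  next
    case (Cons y ys)
    then obtain n' where n': "n = Suc n'" "length ys \<le> n'" by (cases n) auto
    have "(f x ^^ n) (b, y # ys) = (f x ^^ n') (g x y b, ys)"
      unfolding n' funpow_Suc_right by (simp add: f_def)
    then show ?case using Cons.IH[OF n'(2)] by simp
  qed
  note gi = eff_compose[OF g, of "\<lambda>p. (fst (fst p), fst (snd p), fst (snd (snd (fst p))))", simplified]
  have "eff (\<lambda>x. fst (rec_nat (a x, l x) (\<lambda>_ p. case snd p of [] \<Rightarrow> p | y # ys \<Rightarrow> (g x y (fst p), ys)) (code (l x))))"
    by (intro eff_intros eff_code l a gi)
  then have "eff (\<lambda>x. fst (rec_nat (a x, l x) (\<lambda>_. f x) (code (l x))))"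
    by (simp add: f_def)
  then show ?thesis
    unfolding rec it[OF length_le_code] by simp
qed

lemma eff_rev [eff_intros]: assumes "eff f" shows "eff (\<lambda>x. rev (f x))"
proof -
  have "eff (\<lambda>x. fold (\<lambda>y r. y # r) (f x) [])" by (intro eff_intros assms)
  then show ?thesis by (simp add: fold_Cons_rev)
qed

lemma eff_append [eff_intros]: assumes "eff f" "eff g" shows "eff (\<lambda>x. f x @ g x)"
proof -
  have "eff (\<lambda>x. fold (\<lambda>y r. y # r) (rev (f x)) (g x))" by (intro eff_intros assms)
  then show ?thesis by (simp add: fold_Cons_rev)
qed

lemma eff_map [eff_intros]:
  assumes "eff (\<lambda>p. g (fst p) (snd p))" "eff l"
  shows "eff (\<lambda>x. map (\<lambda>y. g x y) (l x))"
proof -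
  have eq: "fold (\<lambda>y r. h y # r) ys zs = rev (map h ys) @ zs" for h :: "'b \<Rightarrow> 'c" and ys zs
    by (induction ys arbitrary: zs) auto
  have "eff (\<lambda>x. rev (fold (\<lambda>y r. g x y # r) (l x) []))"
    by (intro eff_intros assms eff_compose[OF assms(1), of "\<lambda>p. (fst p, fst (snd p))", simplified])
  then show ?thesis unfolding eq by simp
qed

lemma eff_concat [eff_intros]: assumes "eff f" shows "eff (\<lambda>x. concat (f x))"
proof -
  have eq: "fold (\<lambda>y r. r @ y) ys zs = zs @ concat ys" for ys and zs :: "'b list"
    by (induction ys arbitrary: zs) auto
  have "eff (\<lambda>x. fold (\<lambda>y r. r @ y) (f x) [])" by (intro eff_intros assms)
  then show ?thesis unfolding eq by simp
qed

lemma eff_filter [eff_intros]: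
  assumes "dec (\<lambda>p. P (fst p) (snd p))" "eff l"
  shows "eff (\<lambda>x. filter (\<lambda>y. P x y) (l x))"
proof -
  have eq: "concat (map (\<lambda>y. if Q y then [y] else []) ys) = filter Q ys" for Q and ys :: "'b list"
    by (induction ys) auto
  have "eff (\<lambda>x. concat (map (\<lambda>y. if P x y then [y] else []) (l x)))"
    by (intro eff_intros assms)
  then show ?thesis unfolding eq .
qed

lemma eff_sum_list [eff_intros]: assumes "eff f" shows "eff (\<lambda>x. sum_list (f x) :: nat)"
proof -
  have eq: "fold (\<lambda>y r. r + y) ys z = z + sum_list ys" for ys and z :: nat
    by (induction ys arbitrary: z) auto
  have "eff (\<lambda>x. fold (\<lambda>y r. r + y) (f x) 0)" by (intro eff_intros assms)
  then show ?thesis unfolding eq by simp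
qed

lemma eff_length [eff_intros]: assumes "eff f" shows "eff (\<lambda>x. length (f x))"
proof -
  have "eff (\<lambda>x. sum_list (map (\<lambda>_. 1 :: nat) (f x)))" by (intro eff_intros assms)
  then show ?thesis by (simp add: sum_list_triv)
qed

lemma dec_bex [eff_intros]:
  assumes "dec (\<lambda>p. P (fst p) (snd p))" "eff l"
  shows "dec (\<lambda>x. \<exists>y\<in>set (l x). P x y)"
proof -
  have "dec (\<lambda>x. filter (\<lambda>y. P x y) (l x) \<noteq> [])"
    by (intro eff_intros assms)
  then show ?thesis by (simp add: filter_empty_conv)
qed

lemma dec_ball [eff_intros]:
  "dec (\<lambda>p. P (fst p) (snd p)) \<Longrightarrow> eff l \<Longrightarrow> dec (\<lambda>x. \<forall>y\<in>set (l x). P x y)"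
  using dec_not[OF dec_bex[OF dec_not, of P l]] by simp

lemma dec_member [eff_intros]:
  assumes "eff f" "eff l" shows "dec (\<lambda>x. f x \<in> set (l x))"
proof -
  have "dec (\<lambda>x. \<exists>y\<in>set (l x). y = f x)" by (intro eff_intros assms eff_compose[OF assms(1)])
  then show ?thesis by simp
qed

lemma eff_upt [eff_intros]: assumes "eff f" "eff g" shows "eff (\<lambda>x. [f x..<g x])"
proof -
  have eq: "rec_nat [] (\<lambda>y r. if a \<le> y then r @ [y] else r) b = [a..<b]" for a b
    by (induction b) auto
  have "eff (\<lambda>x. rec_nat [] (\<lambda>y r. if f x \<le> y then r @ [y] else r) (g x))"
    by (intro eff_intros assms eff_compose[OF assms(1)])
  then show ?thesis unfolding eq .
qed

lemma eff_drop [eff_intros]: assumes "eff n" "eff l" shows "eff (\<lambda>x. drop (n x) (l x))"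
proof -
  have eq: "rec_nat ys (\<lambda>_ r. case r of [] \<Rightarrow> [] | z # zs \<Rightarrow> zs) k = drop k ys" for ys :: "'b list" and k
  proof (induction k)
    case (Suc k)
    have "drop (Suc k) ys = tl (drop k ys)" by (simp add: drop_Suc tl_drop)
    with Suc show ?case by (cases "drop k ys") auto
  qed simp
  have "eff (\<lambda>x. rec_nat (l x) (\<lambda>_ r. case r of [] \<Rightarrow> [] | z # zs \<Rightarrow> zs) (n x))"
    by (intro eff_intros assms)
  then show ?thesis unfolding eq .
qed

lemma eff_take [eff_intros]: assumes "eff n" "eff l" shows "eff (\<lambda>x. take (n x) (l x))"
proof -
  have "eff (\<lambda>x. rev (drop (length (l x) - n x) (rev (l x))))"
    by (intro eff_intros assms)
  moreover have "rev (drop (length ys - k) (rev ys)) = take k ys" for k and ys :: "'b list"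
    by (cases "k \<le> length ys") (auto simp: rev_drop)
  ultimately show ?thesis by simp
qed

definition entry :: "nat list \<Rightarrow> nat \<Rightarrow> nat" where
  "entry xs i = (case drop i xs of [] \<Rightarrow> 0 | x # _ \<Rightarrow> x)"

lemma entry_nth: "i < length xs \<Longrightarrow> entry xs i = xs ! i"
  by (simp add: entry_def Cons_nth_drop_Suc[symmetric])

lemma eff_entry [eff_intros]: "eff l \<Longrightarrow> eff i \<Longrightarrow> eff (\<lambda>x. entry (l x) (i x))"
  unfolding entry_def by (intro eff_intros)

lemma eff_prod_decode [eff_intros]: "eff f \<Longrightarrow> eff (\<lambda>x. prod_decode (f x))"
  by (erule eff_same_code) (metis code_nat code_pair prod.collapse prod_decode_inverse)

lemma eff_prod_encode [eff_intros]: "eff f \<Longrightarrow> eff (\<lambda>x. prod_encode (f x))"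
  by (erule eff_same_code) (metis code_nat code_pair prod.collapse)

lemma eff_list_decode [eff_intros]: "eff f \<Longrightarrow> eff (\<lambda>x. list_decode (f x))"
  by (erule eff_same_code) (simp add: code_nat_list)

lemma eff_list_encode [eff_intros]: "eff f \<Longrightarrow> eff (\<lambda>x. list_encode (f x))"
  by (erule eff_same_code) (simp add: code_nat_list)

lemma dec_even [eff_intros]: assumes "eff f" shows "dec (\<lambda>x. even (f x :: nat))"
proof -
  have "rec_nat 1 (\<lambda>_ r. 1 - r) n = (of_bool (even n) :: nat)" for n by (induction n) auto
  moreover have "eff (\<lambda>x. rec_nat 1 (\<lambda>_ r. 1 - r) (f x) :: nat)" by (intro eff_intros assms)
  ultimately show ?thesis by (simp add: dec_def)
qed

lemma eff_div [eff_intros]: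
  assumes f: "eff f" and g: "eff g" shows "eff (\<lambda>x. f x div g x :: nat)"
proof -
  \<comment> \<open>The counter grows as long as its next multiple of b fits into a. It stops at the
    quotient, and a rounds suffice because \<open>a div b\<close> is at most a.\<close>
  have eq: "rec_nat 0 (\<lambda>y r. if Suc r * b \<le> a then Suc r else r) n = min n (a div b)"
    if "b > 0" for a b n :: nat
  proof (induction n)
    case (Suc n)
    have "Suc n * b \<le> a \<longleftrightarrow> Suc n \<le> a div b"
      using that by (simp add: less_eq_div_iff_mult_less_eq)
    moreover have "\<not> Suc (a div b) * b \<le> a"
      using that by (metis Suc_n_not_le_n less_eq_div_iff_mult_less_eq)
    ultimately show ?case using Suc by (auto simp: min_def)
  qed simp
  have "eff (\<lambda>x. if g x = 0 then 0 else rec_nat 0 (\<lambda>y r. if Suc r * g x \<le> f x then Suc r else r) (f x))"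
    by (intro eff_intros f g eff_compose[OF f] eff_compose[OF g])
  moreover have "(if b = 0 then 0 else rec_nat 0 (\<lambda>y r. if Suc r * b \<le> a then Suc r else r) a) = a div b" for a b :: nat
    by (cases "b = 0") (simp_all add: eq min_absorb2 del: mult_Suc)
  ultimately show ?thesis by simp
qed

section \<open>Effective operations on integers\<close>

lemma dec_int_nonneg [eff_intros]: assumes "eff f" shows "dec (\<lambda>x. 0 \<le> (f x :: int))"
proof -
  \<comment> \<open>\<open>int_encode\<close> sends i to 2 i if i is non-negative and to - 2 i - 1
    otherwise.\<close>
  have "even (code i) \<longleftrightarrow> 0 \<le> i" for i :: int
    by (simp add: code_int_def int_encode_def sum_encode_def)
  then show ?thesis using dec_even[OF eff_code[OF assms]] by simp
qed

lemma eff_nat [eff_intros]: assumes "eff f" shows "eff (\<lambda>x. nat (f x))"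
proof -
  have eq: "(if even (code i) then code i div 2 else 0) = nat i" for i :: int
    by (auto simp: code_int_def int_encode_def sum_encode_def)
  have "eff (\<lambda>x. if even (code (f x)) then code (f x) div 2 else 0)"
    by (intro eff_intros eff_code assms)
  then show ?thesis unfolding eq .
qed

lemma eff_int [eff_intros]: assumes "eff f" shows "eff (\<lambda>x. int (f x))"
  by (rule eff_same_code[of "\<lambda>x. 2 * f x"])
    (auto intro!: eff_intros assms simp: code_int_def int_encode_def sum_encode_def)

lemma eff_int_Suc [eff_intros]: assumes "eff f" shows "eff (\<lambda>x. f x + 1 :: int)"
proof (rule eff_same_code)
  show "eff (\<lambda>x. if even (code (f x)) then code (f x) + 2 else code (f x) - (if code (f x) = 1 then 1 else 2))"
    by (intro eff_intros eff_code assms)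
  show "code (f x + 1) = code (if even (code (f x)) then code (f x) + 2 else code (f x) - (if code (f x) = 1 then 1 else 2))" for x
    by (auto simp: code_int_def int_encode_def sum_encode_def)
qed

lemma eff_int_pred [eff_intros]: assumes "eff f" shows "eff (\<lambda>x. f x - 1 :: int)"
proof (rule eff_same_code)
  show "eff (\<lambda>x. if even (code (f x)) then (if code (f x) = 0 then 1 else code (f x) - 2) else code (f x) + 2)"
    by (intro eff_intros eff_code assms)
  show "code (f x - 1) = code (if even (code (f x)) then (if code (f x) = 0 then 1 else code (f x) - 2) else code (f x) + 2)" for x
    by (auto simp: code_int_def int_encode_def sum_encode_def)
qed

lemma dec_int_le [eff_intros]: assumes "eff f" "eff g" shows "dec (\<lambda>x. int (f x) \<le> g x)"
proof -
  have "dec (\<lambda>x. 0 \<le> g x \<and> f x \<le> nat (g x))" by (intro eff_intros assms)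
  moreover have "(0 \<le> i \<and> n \<le> nat i) = (int n \<le> i)" for n i by auto
  ultimately show ?thesis by simp
qed

lemma dec_int_less [eff_intros]: "eff f \<Longrightarrow> eff g \<Longrightarrow> dec (\<lambda>x. f x < int (g x))"
  using dec_not[OF dec_int_le, of g f] by (simp add: not_le)


section \<open>Runs of coded machines\<close>

type_synonym event = "int \<times> int \<times> nat \<times> nat"

abbreviation src :: "event \<Rightarrow> int" where "src e \<equiv> fst e"
abbreviation dst :: "event \<Rightarrow> int" where "dst e \<equiv> fst (snd e)"
abbreviation new_state :: "event \<Rightarrow> nat" where "new_state e \<equiv> fst (snd (snd e))"
abbreviation written :: "event \<Rightarrow> nat" where "written e \<equiv> snd (snd (snd e))"

text \<open>Every list \<open>m\<close> of numbers is read as a machine, in the format of \<^const>\<open>tm_encode\<close>; missing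
  entries count as \<open>0\<close>.  The history of a run is the list of its events, latest first; it
  determines the current configuration.\<close>

definition head_pos :: "event list \<Rightarrow> int" where
  "head_pos L = (case L of [] \<Rightarrow> 0 | e # _ \<Rightarrow> dst e)"

definition head_state :: "nat list \<Rightarrow> event list \<Rightarrow> nat" where
  "head_state m L = (case L of [] \<Rightarrow> entry m 5 | e # _ \<Rightarrow> new_state e)"

definition initial_content :: "nat list \<Rightarrow> nat list \<Rightarrow> int \<Rightarrow> nat" where
  "initial_content m w p = (if 0 \<le> p \<and> nat p < length w then entry w (nat p) else entry m 3)"

definition content :: "nat list \<Rightarrow> nat list \<Rightarrow> int \<Rightarrow> event list \<Rightarrow> nat" where
  "content m w p L =
     (case filter (\<lambda>e. src e = p) L of [] \<Rightarrow> initial_content m w p | e # _ \<Rightarrow> written e)"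

definition table_entry :: "nat list \<Rightarrow> nat \<Rightarrow> nat \<Rightarrow> nat \<times> nat" where
  "table_entry m q a = prod_decode (entry (list_decode (entry m 4)) (q * entry m 1 + a))"

text \<open>Every direction code except 0 means a move to the right, so the head changes its cell in
  each event even if m codes no machine.\<close>

definition next_event :: "nat list \<Rightarrow> nat list \<Rightarrow> event list \<Rightarrow> event" where
  "next_event m w L =
     (let p = head_pos L; t = table_entry m (head_state m L) (content m w p L);
          u = prod_decode (snd t)
      in (p, if snd u = 0 then p - 1 else p + 1, fst t, fst u))"

primrec run :: "nat list \<Rightarrow> nat list \<Rightarrow> nat \<Rightarrow> event list" where
  "run m w 0 = []"
| "run m w (Suc s) = next_event m w (run m w s) # run m w s"

definition halted :: "nat list \<Rightarrow> nat \<Rightarrow> bool" where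
  "halted m q \<longleftrightarrow> q = entry m 6 \<or> q = entry m 7"

text \<open>\<open>run\<close> goes on past halting states; this predicate says that its first s
  events are genuine steps.\<close>

definition alive :: "nat list \<Rightarrow> nat list \<Rightarrow> nat \<Rightarrow> bool" where
  "alive m w s \<longleftrightarrow> (\<forall>r<s. \<not> halted m (head_state m (run m w r)))"

text \<open>Boundary \<open>b\<close> separates the cells \<open>b - 1\<close> and \<open>b\<close>.\<close>

definition crosses :: "int \<Rightarrow> event \<Rightarrow> bool" where
  "crosses b e \<longleftrightarrow> src e = b - 1 \<and> dst e = b \<or> src e = b \<and> dst e = b - 1"

definition crossings :: "int \<Rightarrow> event list \<Rightarrow> nat list" where
  "crossings b L = map new_state (filter (crosses b) L)"

definition visits :: "int \<Rightarrow> int \<Rightarrow> event list \<Rightarrow> nat" where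
  "visits i j L = length (filter (\<lambda>e. i \<le> src e \<and> src e < j) L)"

lemma length_run [simp]: "length (run m w s) = s"
  by (induction s) auto

lemma alive_0 [simp]: "alive m w 0" by (simp add: alive_def)

lemma alive_Suc: "alive m w (Suc s) \<longleftrightarrow> alive m w s \<and> \<not> halted m (head_state m (run m w s))"
  by (auto simp: alive_def less_Suc_eq)

lemma alive_mono: "alive m w s \<Longrightarrow> r \<le> s \<Longrightarrow> alive m w r"
  by (auto simp: alive_def)

lemma src_next_event [simp]: "src (next_event m w L) = head_pos L"
  by (simp add: next_event_def Let_def)

lemma dst_next_event: "dst (next_event m w L) = head_pos L - 1 \<or> dst (next_event m w L) = head_pos L + 1"
  by (simp add: next_event_def Let_def)

lemma head_Cons [simp]: "head_pos (e # L) = dst e" "head_state m (e # L) = new_state e"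
  by (simp_all add: head_pos_def head_state_def)

lemma head_Nil [simp]: "head_pos [] = 0" "head_state m [] = entry m 5"
  by (simp_all add: head_pos_def head_state_def)

lemma crossings_Nil [simp]: "crossings b [] = []" by (simp add: crossings_def)

lemma crossings_Cons: "crossings b (e # L) = (if crosses b e then new_state e # crossings b L else crossings b L)"
  by (simp add: crossings_def)

text \<open>The head starts on cell 0, which is left of every boundary b >= 1, and each crossing
  changes the side. Hence equal crossing sequences put the heads of two runs on the same side. For b
  <= 0 the parities would be reversed.\<close>

lemma head_left_iff_even_crossings:
  assumes "1 \<le> b" shows "head_pos (run m w s) < b \<longleftrightarrow> even (length (crossings b (run m w s)))"
proof (induction s)
  case 0 show ?case using assms by simp
next
  case (Suc s)
  then show ?case using dst_next_event[of m w "run m w s"]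
    by (auto simp: crossings_Cons crosses_def)
qed


section \<open>Splicing runs\<close>

definition shift_event :: "int \<Rightarrow> event \<Rightarrow> event" where
  "shift_event d e = (src e + d, dst e + d, snd (snd e))"

text \<open>X looks like A to the left of boundary i and like B, moved by i - j, to the right of it.
  Crossings of i start on both sides and need a clause of their own. The head comes from A while A
  is on the left and from B otherwise.\<close>

definition spliced :: "nat list \<Rightarrow> int \<Rightarrow> int \<Rightarrow> event list \<Rightarrow> event list \<Rightarrow> event list \<Rightarrow> bool" where
  "spliced m i j A B X \<longleftrightarrow>
     filter (\<lambda>e. src e < i) X = filter (\<lambda>e. src e < i) A \<and>
     filter (\<lambda>e. i \<le> src e) X = map (shift_event (i - j)) (filter (\<lambda>e. j \<le> src e) B) \<and>
     crossings i X = crossings i A \<and>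
     (if head_pos A < i then head_pos X = head_pos A \<and> head_state m X = head_state m A
      else head_pos X = head_pos B + (i - j) \<and> head_state m X = head_state m B)"

lemma content_cong:
  "initial_content m w p = initial_content m w' p' \<Longrightarrow>
   map written (filter (\<lambda>e. src e = p) L) = map written (filter (\<lambda>e. src e = p') L') \<Longrightarrow>
   content m w p L = content m w' p' L'"
  unfolding content_def
  by (cases "filter (\<lambda>e. src e = p) L"; cases "filter (\<lambda>e. src e = p') L'") auto

lemma entry_append: "entry (xs @ ys) k = (if k < length xs then entry xs k else entry ys (k - length xs))"
  by (auto simp: entry_def split: list.split)

lemma entry_drop: "entry (drop j xs) k = entry xs (k + j)"
  by (simp add: entry_def)

lemma entry_take: "k < i \<Longrightarrow> entry (take i xs) k = entry xs k"
  by (cases "drop k xs"; cases "i - k") (auto simp: entry_def drop_take)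

text \<open>An event depends only on the state, the position and the content of the scanned cell.
  Left of i this content is determined by the first i letters and by the events starting
  there.\<close>

lemma next_event_left:
  assumes "spliced m (int i) (int j) A B X" "head_pos A < int i" "i \<le> length u"
  shows "next_event m (take i u @ drop j v) X = next_event m u A"
proof -
  let ?p = "head_pos A"
  have eq: "filter (\<lambda>e. src e = ?p) L = filter (\<lambda>e. src e = ?p) (filter (\<lambda>e. src e < int i) L)" for L :: "event list"
    using assms(2) by (auto intro!: filter_cong)
  have "filter (\<lambda>e. src e = ?p) X = filter (\<lambda>e. src e = ?p) A"
    unfolding eq[of X] eq[of A] using assms(1) by (simp add: spliced_def del: filter_filter)
  moreover have "initial_content m (take i u @ drop j v) ?p = initial_content m u ?p"
    using assms(2,3) by (auto simp: initial_content_def entry_append entry_take)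
  ultimately have "content m (take i u @ drop j v) ?p X = content m u ?p A"
    by (intro content_cong) simp_all
  then show ?thesis using assms(1,2) by (simp add: next_event_def spliced_def)
qed

lemma next_event_right:
  assumes "spliced m (int i) (int j) A B X" "int i \<le> head_pos A" "int j \<le> head_pos B"
    and "i \<le> length u" "j \<le> length v"
  shows "next_event m (take i u @ drop j v) X = shift_event (int i - int j) (next_event m v B)"
proof -
  let ?p = "head_pos B" let ?d = "int i - int j"
  have "filter (\<lambda>e. src e = ?p + ?d) X = filter (\<lambda>e. src e = ?p + ?d) (filter (\<lambda>e. int i \<le> src e) X)"
    using assms(3) by (auto intro!: filter_cong)
  also have "\<dots> = map (shift_event ?d) (filter (\<lambda>e. src e = ?p) (filter (\<lambda>e. int j \<le> src e) B))"
    using assms(1) by (simp add: spliced_def filter_map comp_def shift_event_def)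
  also have "filter (\<lambda>e. src e = ?p) (filter (\<lambda>e. int j \<le> src e) B) = filter (\<lambda>e. src e = ?p) B"
    using assms(3) by (auto intro!: filter_cong)
  finally have "map written (filter (\<lambda>e. src e = ?p + ?d) X) = map written (filter (\<lambda>e. src e = ?p) B)"
    by (simp add: shift_event_def)
  moreover have "initial_content m (take i u @ drop j v) (?p + ?d) = initial_content m v ?p"
  proof -
    have n: "nat (?p + ?d) = nat (?p - int j) + i" "nat ?p = nat (?p - int j) + j"
      using assms(3) by linarith+
    show ?thesis
      using assms(3-5) by (auto simp: initial_content_def entry_append entry_drop n)
  qed
  ultimately have "content m (take i u @ drop j v) (?p + ?d) X = content m v ?p B"
    by (intro content_cong)
  then show ?thesis using assms(1,2) by (simp add: next_event_def spliced_def shift_event_def Let_def)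
qed

text \<open>Induction on s + t, taking off latest events. An event that does not cross is taken off
  alone: on the side which the spliced run takes from its run it becomes a step of the spliced run,
  on the other side it leaves no trace. Two crossing events enter the same state and are taken off
  together, as one step of the spliced run.\<close>

lemma splice_runs:
  fixes i j :: nat
  assumes ij: "1 \<le> i" "i \<le> length u" "1 \<le> j" "j \<le> length v"
    and "alive m u s" "alive m v t"
    and "crossings (int i) (run m u s) = crossings (int j) (run m v t)"
  shows "\<exists>r. alive m (take i u @ drop j v) r \<and>
    spliced m (int i) (int j) (run m u s) (run m v t) (run m (take i u @ drop j v) r)"
  using assms(5-)
proof (induction "s + t" arbitrary: s t rule: less_induct)
  case less
  let ?x = "take i u @ drop j v"
  let ?A = "run m u" and ?B = "run m v" and ?X = "run m ?x"
  note IH = less.hyps and al = less.prems(1,2) and cr = less.prems(3)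
  have even_eq: "head_pos (?A s') < int i \<longleftrightarrow> head_pos (?B t') < int j"
    if "crossings (int i) (?A s') = crossings (int j) (?B t')" for s' t'
    using that ij by (simp add: head_left_iff_even_crossings)
  note side = even_eq[OF cr]
  have dstA: "dst (next_event m u (?A s')) = head_pos (?A s') - 1 \<or> dst (next_event m u (?A s')) = head_pos (?A s') + 1" for s'
    by (rule dst_next_event)
  have dstB: "dst (next_event m v (?B s')) = head_pos (?B s') - 1 \<or> dst (next_event m v (?B s')) = head_pos (?B s') + 1" for s'
    by (rule dst_next_event)
  consider (dropA) s' where "s = Suc s'" "\<not> crosses (int i) (next_event m u (?A s'))"
    | (dropB) t' where "t = Suc t'" "\<not> crosses (int j) (next_event m v (?B t'))"
    | (both) s' t' where "s = Suc s'" "t = Suc t'" "crosses (int i) (next_event m u (?A s'))"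
      "crosses (int j) (next_event m v (?B t'))"
    | (none) "s = 0" "t = 0"
    using cr by (cases s; cases t) (auto simp: crossings_Cons split: if_splits)
  then show ?case
  proof cases
    case none
    then show ?thesis using ij by (intro exI[of _ 0]) (simp add: spliced_def)
  next
    case dropA
    have cr': "crossings (int i) (?A s') = crossings (int j) (?B t)"
      using cr dropA by (simp add: crossings_Cons)
    have "alive m u s'" using al(1) dropA by (simp add: alive_Suc)
    from IH[OF _ this al(2) cr'] dropA obtain r where r: "alive m ?x r" "spliced m i j (?A s') (?B t) (?X r)"
      by auto
    have stay: "head_pos (?A s') < int i \<longleftrightarrow> head_pos (?A s) < int i"
      using dropA dstA[of s'] by (auto simp: crosses_def)
    show ?thesis
    proof (cases "head_pos (?A s) < int i")
      case True
      have e: "next_event m ?x (?X r) = next_event m u (?A s')"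
        using next_event_left r(2) True stay ij(2) by blast
      have "head_state m (?X r) = head_state m (?A s')" using r(2) True stay by (simp add: spliced_def)
      then have "alive m ?x (Suc r)" using r(1) al(1) dropA by (simp add: alive_Suc)
      moreover have "spliced m i j (?A s) (?B t) (?X (Suc r))"
        using r(2) dropA True stay by (auto simp: spliced_def e crossings_Cons)
      ultimately show ?thesis by blast
    next
      case False
      have "spliced m i j (?A s) (?B t) (?X r)"
        using r(2) dropA False stay by (auto simp: spliced_def crossings_Cons)
      then show ?thesis using r(1) by blast
    qed
  next
    case dropB
    have cr': "crossings (int i) (?A s) = crossings (int j) (?B t')"
      using cr dropB by (simp add: crossings_Cons)
    have "alive m v t'" using al(2) dropB by (simp add: alive_Suc)
    from IH[OF _ al(1) this cr'] dropB obtain r where r: "alive m ?x r" "spliced m i j (?A s) (?B t') (?X r)"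
      by auto
    have stay: "head_pos (?B t') < int j \<longleftrightarrow> head_pos (?B t) < int j"
      using dropB dstB[of t'] by (auto simp: crosses_def)
    show ?thesis
    proof (cases "head_pos (?B t) < int j")
      case False
      then have A: "int i \<le> head_pos (?A s)" using side by simp
      have B: "int j \<le> head_pos (?B t')" using False stay by simp
      have e: "next_event m ?x (?X r) = shift_event (int i - int j) (next_event m v (?B t'))"
        using next_event_right[OF r(2) A B ij(2,4)] .
      have "head_state m (?X r) = head_state m (?B t')" using r(2) A by (simp add: spliced_def)
      then have "alive m ?x (Suc r)" using r(1) al(2) dropB by (simp add: alive_Suc)
      moreover have "spliced m i j (?A s) (?B t) (?X (Suc r))"
        using r(2) dropB A B stay False side by (auto simp: spliced_def e crossings_Cons shift_event_def crosses_def)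
      ultimately show ?thesis by blast
    next
      case True
      have "spliced m i j (?A s) (?B t) (?X r)"
        using r(2) dropB True stay side by (auto simp: spliced_def crossings_Cons)
      then show ?thesis using r(1) by blast
    qed
  next
    case both
    have cr': "crossings (int i) (?A s') = crossings (int j) (?B t')"
      and st: "new_state (next_event m u (?A s')) = new_state (next_event m v (?B t'))"
      using cr both by (simp_all add: crossings_Cons)
    have al': "alive m u s'" "alive m v t'" using al both by (simp_all add: alive_Suc)
    from IH[OF _ al' cr'] both obtain r where r: "alive m ?x r" "spliced m i j (?A s') (?B t') (?X r)"
      by auto
    note side' = even_eq[OF cr']
    show ?thesis
    proof (cases "head_pos (?A s') < int i")
      case True
      have e: "next_event m ?x (?X r) = next_event m u (?A s')"
        using next_event_left r(2) True ij(2) by blast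
      have "head_state m (?X r) = head_state m (?A s')" using r(2) True by (simp add: spliced_def)
      then have "alive m ?x (Suc r)" using r(1) al(1) both by (simp add: alive_Suc)
      moreover have "spliced m i j (?A s) (?B t) (?X (Suc r))"
        using r(2) both True side' st by (auto simp: spliced_def e crossings_Cons crosses_def)
      ultimately show ?thesis by blast
    next
      case False
      then have A: "int i \<le> head_pos (?A s')" and B: "int j \<le> head_pos (?B t')" using side' by simp_all
      have e: "next_event m ?x (?X r) = shift_event (int i - int j) (next_event m v (?B t'))"
        using next_event_right[OF r(2) A B ij(2,4)] .
      have "head_state m (?X r) = head_state m (?B t')" using r(2) A by (simp add: spliced_def)
      then have "alive m ?x (Suc r)" using r(1) al(2) both by (simp add: alive_Suc)
      moreover have "spliced m i j (?A s) (?B t) (?X (Suc r))"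
        using r(2) both A B side' st by (auto simp: spliced_def e crossings_Cons shift_event_def crosses_def)
      ultimately show ?thesis by blast
    qed
  qed
qed

text \<open>For b < i a crossing of b starts on cell b - 1 or b, both left of i. The case b = i is
  the separate clause of \<open>spliced\<close>.\<close>

lemma spliced_crossings_left:
  assumes "spliced m i j A B X" "b \<le> i" shows "crossings b X = crossings b A"
proof (cases "b = i")
  case False
  have eq: "filter (crosses b) L = filter (crosses b) (filter (\<lambda>e. src e < i) L)" for L
    using assms(2) False by (auto simp: crosses_def intro!: filter_cong)
  show ?thesis unfolding crossings_def eq[of X] eq[of A]
    using assms(1) by (simp add: spliced_def del: filter_filter)
qed (use assms in \<open>simp add: spliced_def\<close>)

lemma spliced_crossings_right:
  assumes "spliced m i j A B X" "crossings i A = crossings j B" "i \<le> b"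
  shows "crossings b X = crossings (b - i + j) B"
proof (cases "b = i")
  case False
  have "filter (crosses b) X = filter (crosses b) (filter (\<lambda>e. i \<le> src e) X)"
    using assms(3) False by (auto simp: crosses_def intro!: filter_cong)
  also have "\<dots> = map (shift_event (i - j)) (filter (crosses (b - i + j)) (filter (\<lambda>e. j \<le> src e) B))"
    using assms(1) by (auto simp: spliced_def filter_map comp_def shift_event_def crosses_def algebra_simps intro!: arg_cong[where f = "map _"] filter_cong)
  also have "filter (crosses (b - i + j)) (filter (\<lambda>e. j \<le> src e) B) = filter (crosses (b - i + j)) B"
    using assms(3) False by (auto simp: crosses_def intro!: filter_cong)
  finally show ?thesis by (simp add: crossings_def shift_event_def)
qed (use assms in \<open>simp add: spliced_def\<close>)

lemma spliced_visits_left: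
  assumes "spliced m i j A B X" "b \<le> i" shows "visits a b X = visits a b A"
proof -
  have eq: "filter (\<lambda>e. a \<le> src e \<and> src e < b) L = filter (\<lambda>e. a \<le> src e \<and> src e < b) (filter (\<lambda>e. src e < i) L)" for L :: "event list"
    using assms(2) by (auto intro!: filter_cong)
  show ?thesis unfolding visits_def eq[of X] eq[of A]
    using assms(1) by (simp add: spliced_def del: filter_filter)
qed

lemma spliced_visits_right:
  assumes "spliced m i j A B X" "i \<le> a" shows "visits a b X = visits (a - i + j) (b - i + j) B"
proof -
  have "filter (\<lambda>e. a \<le> src e \<and> src e < b) X = filter (\<lambda>e. a \<le> src e \<and> src e < b) (filter (\<lambda>e. i \<le> src e) X)"
    using assms(2) by (auto intro!: filter_cong)
  also have "\<dots> = map (shift_event (i - j)) (filter (\<lambda>e. a - i + j \<le> src e \<and> src e < b - i + j) (filter (\<lambda>e. j \<le> src e) B))"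
    using assms(1) by (auto simp: spliced_def filter_map comp_def shift_event_def algebra_simps intro!: arg_cong[where f = "map _"] filter_cong)
  also have "filter (\<lambda>e. a - i + j \<le> src e \<and> src e < b - i + j) (filter (\<lambda>e. j \<le> src e) B) = filter (\<lambda>e. a - i + j \<le> src e \<and> src e < b - i + j) B"
    using assms(2) by (auto intro!: filter_cong)
  finally show ?thesis by (simp add: visits_def)
qed

lemma length_split_filter: "length L = length (filter P L) + length (filter (\<lambda>e. \<not> P e) L)"
  by (induction L) auto

lemma length_split_visits:
  assumes "i \<le> j"
  shows "length L = length (filter (\<lambda>e. src e < i) L) + visits i j L + length (filter (\<lambda>e. j \<le> src e) L)"
  using assms by (induction L) (auto simp: visits_def)

lemma spliced_length:
  assumes "spliced m i j A B X"
  shows "length X = length (filter (\<lambda>e. src e < i) A) + length (filter (\<lambda>e. j \<le> src e) B)"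
proof -
  have "length X = length (filter (\<lambda>e. src e < i) X) + length (filter (\<lambda>e. i \<le> src e) X)"
    using length_split_filter[of X "\<lambda>e. src e < i"] by (simp add: not_less)
  then show ?thesis using assms by (simp add: spliced_def)
qed

text \<open>A run is spliced with itself. The time saved is the time spent on the removed cells, and
  no crossing sequence outside of them changes.\<close>

lemma cut_cycle:
  fixes i j :: nat
  assumes "1 \<le> i" "i < j" "j \<le> length w" and "alive m w s"
    and "crossings i (run m w s) = crossings j (run m w s)"
  defines "x \<equiv> take i w @ drop j w"
  obtains r where "alive m x r" "s = r + visits i j (run m w s)"
    "\<And>b :: nat. b \<le> i \<Longrightarrow> crossings b (run m x r) = crossings b (run m w s)"
    "\<And>b :: nat. j \<le> b \<Longrightarrow> crossings (int (b - (j - i))) (run m x r) = crossings b (run m w s)"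
proof -
  obtain r where r: "alive m x r" "spliced m (int i) (int j) (run m w s) (run m w s) (run m x r)"
    using splice_runs[of i w j w m s s] assms by auto
  have "s = r + visits i j (run m w s)"
    using spliced_length[OF r(2)] length_split_visits[of "int i" "int j" "run m w s"] assms(2) by simp
  moreover have "crossings b (run m x r) = crossings b (run m w s)" if "b \<le> i" for b :: nat
    using spliced_crossings_left[OF r(2), of "int b"] that by simp
  moreover have "crossings (int (b - (j - i))) (run m x r) = crossings b (run m w s)" if "j \<le> b" for b :: nat
    using spliced_crossings_right[OF r(2) assms(5), of "int (b - (j - i))"] that assms(2)
    by (simp add: of_nat_diff algebra_simps)
  ultimately show ?thesis using that r(1) by blast
qed

text \<open>Two splices: one passes from u at i to v at j, the other from v at k back to u at i.
  They fit because the three crossing sequences coincide. The piece may come from a different run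
  than the one that receives it.\<close>

lemma insert_cycle:
  fixes i j k :: nat
  assumes i: "1 \<le> i" "i \<le> length u" and jk: "1 \<le> j" "j \<le> k" "k \<le> length v"
    and al: "alive m u s" "alive m v t"
    and cr: "crossings i (run m u s) = crossings j (run m v t)" "crossings j (run m v t) = crossings k (run m v t)"
  defines "x \<equiv> take i u @ take (k - j) (drop j v) @ drop i u"
    and "\<tau> \<equiv> visits j k (run m v t)"
  shows "alive m x (s + \<tau>)" "visits i (int (i + (k - j))) (run m x (s + \<tau>)) = \<tau>"
    "\<And>b :: nat. b \<le> i \<Longrightarrow> crossings b (run m x (s + \<tau>)) = crossings b (run m u s)"
    "\<And>b :: nat. i \<le> b \<Longrightarrow> crossings (int (b + (k - j))) (run m x (s + \<tau>)) = crossings b (run m u s)"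
proof -
  define d where "d = k - j"
  define y where "y = take i u @ drop j v"
  obtain r where r: "alive m y r" "spliced m (int i) (int j) (run m u s) (run m v t) (run m y r)"
    using splice_runs[of i u j v m s t] i jk al cr unfolding y_def by fastforce
  \<comment> \<open>Boundary i + d of the intermediate word y is boundary k of v.\<close>
  have kd: "int (i + d) - int i + int j = int k" using jk unfolding d_def by simp
  have crk: "crossings (int (i + d)) (run m y r) = crossings i (run m u s)"
    using spliced_crossings_right[OF r(2) cr(1), of "int (i + d)"] cr unfolding kd by simp
  have ly: "i + d \<le> length y" using i jk by (simp add: y_def d_def)
  have xy: "take (i + d) y @ drop i u = x" using i jk by (simp add: x_def y_def d_def)
  obtain r' where r': "alive m x r'" "spliced m (int (i + d)) (int i) (run m y r) (run m u s) (run m x r')"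
    using splice_runs[of "i + d" y i u m r s] i ly r(1) al(1) crk unfolding xy by auto
  have vis_y: "visits i (int (i + d)) (run m y r) = \<tau>"
    using spliced_visits_right[OF r(2), of "int i" "int (i + d)"] unfolding kd \<tau>_def by simp
  have lt: "length (filter (\<lambda>e. src e < int (i + d)) L) =
      length (filter (\<lambda>e. src e < int i) L) + visits i (int (i + d)) L" for L
    by (induction L) (auto simp: visits_def)
  have "filter (\<lambda>e. src e < int i) (run m y r) = filter (\<lambda>e. src e < int i) (run m u s)"
    using r(2) by (simp add: spliced_def)
  then have "r' = length (filter (\<lambda>e. src e < int i) (run m u s)) + \<tau> + length (filter (\<lambda>e. int i \<le> src e) (run m u s))"
    using spliced_length[OF r'(2)] lt[of "run m y r"] vis_y by simp
  also have "\<dots> = s + \<tau>"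
    using length_split_filter[of "run m u s" "\<lambda>e. src e < int i"] by (simp add: not_less)
  finally have r'_eq: "r' = s + \<tau>" .
  show "alive m x (s + \<tau>)" using r'(1) r'_eq by simp
  show "visits i (int (i + (k - j))) (run m x (s + \<tau>)) = \<tau>"
    using spliced_visits_left[OF r'(2), of "int (i + d)" "int i"] vis_y r'_eq by (simp add: d_def)
  show "crossings b (run m x (s + \<tau>)) = crossings b (run m u s)" if "b \<le> i" for b :: nat
    using spliced_crossings_left[OF r'(2), of "int b"] spliced_crossings_left[OF r(2), of "int b"] that r'_eq by simp
  show "crossings (int (b + (k - j))) (run m x (s + \<tau>)) = crossings b (run m u s)" if "i \<le> b" for b :: nat
    using spliced_crossings_right[OF r'(2) crk, of "int (b + d)"] that r'_eq by (simp add: d_def)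
qed


section \<open>Counting crossing sequences\<close>

text \<open>The sum replaces a maximum. Missing table entries decode to state 0, so the bound is
  strict for every list m.\<close>

definition state_bound :: "nat list \<Rightarrow> nat" where
  "state_bound m = Suc (entry m 5 + sum_list (map (\<lambda>e. fst (prod_decode e)) (list_decode (entry m 4))))"

lemma entry_cases: "entry xs k \<in> set xs \<or> entry xs k = 0"
  by (cases "k < length xs") (auto simp: entry_nth, auto simp: entry_def)

lemma fst_table_entry_less: "fst (table_entry m q a) < state_bound m"
proof -
  let ?xs = "list_decode (entry m 4)"
  have "fst (prod_decode (entry ?xs k)) \<le> sum_list (map (\<lambda>e. fst (prod_decode e)) ?xs)" for k
  proof (cases "entry ?xs k \<in> set ?xs")
    case True then show ?thesis by (intro member_le_sum_list) auto
  next
    case False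
    then have "entry ?xs k = 0" using entry_cases by blast
    then show ?thesis using le_prod_encode_1[of "fst (prod_decode 0)" "snd (prod_decode 0)"] by simp
  qed
  then show ?thesis unfolding state_bound_def table_entry_def by (simp add: less_Suc_eq_le trans_le_add2)
qed

lemma new_state_less: "e \<in> set (run m w s) \<Longrightarrow> new_state e < state_bound m"
  by (induction s) (auto simp: next_event_def Let_def fst_table_entry_less)

lemma set_crossings: "set (crossings b (run m w s)) \<subseteq> {..<state_bound m}"
  using new_state_less by (auto simp: crossings_def)

definition short_seqs :: "nat \<Rightarrow> nat \<Rightarrow> nat list set" where
  "short_seqs q c = {xs. set xs \<subseteq> {..<q} \<and> length xs \<le> c}"

lemma finite_short_seqs: "finite (short_seqs q c)"
  unfolding short_seqs_def by (rule finite_lists_length_le) simp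

lemma card_short_seqs: "card (short_seqs q c) \<le> Suc q ^ c"
proof -
  have "(\<Sum>i\<le>c. q ^ i) \<le> Suc q ^ c"
  proof (induction c)
    case (Suc c)
    have "q * q ^ c \<le> q * Suc q ^ c" by (intro mult_left_mono power_mono) auto
    from add_mono[OF Suc this] show ?case by simp
  qed simp
  then show ?thesis by (simp add: short_seqs_def card_lists_length_le)
qed

lemma repetition:
  fixes f :: "nat \<Rightarrow> 'a"
  assumes "finite F" "f ` {a..<b} \<subseteq> F" "card F < b - a"
  obtains i j where "a \<le> i" "i < j" "j < b" "f i = f j"
proof -
  have "card (f ` {a..<b}) \<le> card F" using assms by (intro card_mono)
  then have "\<not> inj_on f {a..<b}" using assms(3) by (intro pigeonhole) simp
  then obtain i j where "i \<in> {a..<b}" "j \<in> {a..<b}" "f i = f j" "i \<noteq> j" by (auto simp: inj_on_def)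
  then show ?thesis using that[of i j] that[of j i] by (cases "i < j") auto
qed

text \<open>Every block of \<open>k + 1\<close> consecutive places contains a repetition.  If each of them were the only
  home of some value, these values would be \<open>k + 1\<close> different ones.\<close>

lemma redundant_interval:
  fixes f :: "nat \<Rightarrow> 'a"
  assumes F: "finite F" "f ` {1..n} \<subseteq> F" "card F \<le> k" and n: "(k + 1) * (k + 1) \<le> n"
  obtains i j where "1 \<le> i" "i < j" "j \<le> n" "j - i \<le> k" "f i = f j"
    "\<And>b. b \<in> {i<..j} \<Longrightarrow> \<exists>b'\<in>{1..n} - {i<..j}. f b' = f b"
proof -
  let ?blk = "\<lambda>t. {t * (k + 1) + 1..<t * (k + 1) + k + 2}"
  have blk: "?blk t \<subseteq> {1..n}" if "t \<le> k" for t
  proof -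
    have "t * (k + 1) + k + 1 \<le> k * (k + 1) + (k + 1)"
      using mult_right_mono[OF that, of "k + 1"] by simp
    also have "\<dots> \<le> n" using n by simp
    finally show ?thesis by auto
  qed
  have "\<exists>i j. i \<in> ?blk t \<and> j \<in> ?blk t \<and> i < j \<and> f i = f j" if "t \<le> k" for t
  proof -
    have "f ` ?blk t \<subseteq> F" using F(2) blk[OF that] by blast
    moreover have "card F < t * (k + 1) + k + 2 - (t * (k + 1) + 1)" using F(3) by simp
    ultimately obtain i j where "t * (k + 1) + 1 \<le> i" "i < j" "j < t * (k + 1) + k + 2" "f i = f j"
      using repetition[OF F(1)] by metis
    then show ?thesis by (intro exI[of _ i] exI[of _ j]) auto
  qed
  then obtain i j where ij: "\<And>t. t \<le> k \<Longrightarrow> i t \<in> ?blk t \<and> j t \<in> ?blk t \<and> i t < j t \<and> f (i t) = f (j t)"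
    by metis
  have "\<exists>t\<le>k. \<forall>b\<in>{i t<..j t}. \<exists>b'\<in>{1..n} - {i t<..j t}. f b' = f b"
  proof (rule ccontr)
    assume "\<not> ?thesis"
    then obtain b where b: "\<And>t. t \<le> k \<Longrightarrow> b t \<in> {i t<..j t} \<and> (\<forall>b'\<in>{1..n} - {i t<..j t}. f b' \<noteq> f (b t))"
      by metis
    have sub: "{i t<..j t} \<subseteq> ?blk t" if "t \<le> k" for t using ij[OF that] by auto
    have disj: "?blk t \<inter> ?blk t' = {}" if "t < t'" for t t'
    proof -
      have "Suc t * (k + 1) \<le> t' * (k + 1)" using that by (intro mult_right_mono) auto
      then show ?thesis by auto
    qed
    have "inj_on (\<lambda>t. f (b t)) {..k}"
    proof (rule linorder_inj_onI')
      fix t t' assume t: "t \<in> {..k}" "t' \<in> {..k}" "t < t'"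
      have "b t' \<in> ?blk t'" using b[of t'] sub[of t'] t by blast
      moreover from this have "b t' \<notin> {i t<..j t}" using sub[of t] disj[OF t(3)] t(1) by blast
      ultimately have "b t' \<in> {1..n} - {i t<..j t}" using blk[of t'] t by blast
      then show "f (b t) \<noteq> f (b t')" using b[of t] t by fastforce
    qed
    moreover have "(\<lambda>t. f (b t)) ` {..k} \<subseteq> F"
    proof (intro image_subsetI)
      fix t assume "t \<in> {..k}"
      then have "b t \<in> {1..n}" using b[of t] sub[of t] blk[of t] by blast
      then show "f (b t) \<in> F" using F(2) by blast
    qed
    ultimately have "card {..k} \<le> card F" using F(1) by (metis card_image card_mono)
    then show False using F(3) by simp
  qed
  then obtain t where t: "t \<le> k" "\<forall>b\<in>{i t<..j t}. \<exists>b'\<in>{1..n} - {i t<..j t}. f b' = f b" by blast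
  have "i t \<in> {1..n}" "j t \<in> {1..n}" using ij[OF t(1)] blk[OF t(1)] by blast+
  moreover have "j t - i t \<le> k" using ij[OF t(1)] by auto
  ultimately show ?thesis using that[of "i t" "j t"] ij[OF t(1)] t(2) by auto
qed

text \<open>An event crosses at most one boundary.\<close>

lemma sum_crossings_le:
  assumes "finite B" shows "(\<Sum>b\<in>B. length (crossings (int b) L)) \<le> length L"
proof (induction L)
  case (Cons e L)
  have "(\<Sum>b\<in>B. of_bool (crosses (int b) e) :: nat) \<le> 1"
  proof (cases "\<exists>b\<in>B. crosses (int b) e")
    case True
    then obtain b where b: "b \<in> B" "crosses (int b) e" by blast
    then have "crosses (int c) e \<longleftrightarrow> c = b" for c by (auto simp: crosses_def)
    then show ?thesis using assms by (simp add: sum.delta of_bool_def)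
  qed simp
  moreover have "(\<Sum>b\<in>B. length (crossings (int b) (e # L))) =
      (\<Sum>b\<in>B. of_bool (crosses (int b) e)) + (\<Sum>b\<in>B. length (crossings (int b) L))"
    unfolding sum.distrib[symmetric] by (intro sum.cong) (auto simp: crossings_Cons)
  ultimately show ?case using Cons by simp
qed simp

lemma crossings_Suc_length:
  "length (crossings b (run m w (Suc s))) \<le> Suc (length (crossings b (run m w s)))"
  by (simp add: crossings_Cons)


section \<open>Bounded crossing sequences\<close>

definition crossings_le :: "nat list \<Rightarrow> nat \<Rightarrow> nat list \<Rightarrow> nat \<Rightarrow> bool" where
  "crossings_le m c w s \<longleftrightarrow> (\<forall>b\<in>{1..length w}. length (crossings (int b) (run m w s)) \<le> c)"

lemma crossings_in_short_seqs:
  "crossings_le m c w s \<Longrightarrow> b \<in> {1..length w} \<Longrightarrow> crossings (int b) (run m w s) \<in> short_seqs (state_bound m) c"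
  using set_crossings by (auto simp: crossings_le_def short_seqs_def)

text \<open>A cut on one side of b leaves the crossing sequence of b intact. The boundary b may
  itself be an end of the cut.\<close>

lemma shorter_much_crossed:
  assumes w: "w \<in> lists S" "alive m w s" "b \<in> {1..length w}"
    and ij: "1 \<le> i" "i < j" "j \<le> length w" "j \<le> b \<or> b \<le> i"
    and cr: "crossings (int i) (run m w s) = crossings (int j) (run m w s)"
  obtains x r b' where "x \<in> lists S" "length x < length w" "alive m x r" "b' \<in> {1..length x}"
    "crossings (int b') (run m x r) = crossings (int b) (run m w s)"
proof -
  let ?x = "take i w @ drop j w"
  obtain r where r: "alive m ?x r"
    "\<And>b :: nat. b \<le> i \<Longrightarrow> crossings b (run m ?x r) = crossings b (run m w s)"
    "\<And>b :: nat. j \<le> b \<Longrightarrow> crossings (int (b - (j - i))) (run m ?x r) = crossings b (run m w s)"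
    using cut_cycle[OF ij(1-3) w(2) cr] by metis
  have x: "?x \<in> lists S" using w(1) by (auto dest: in_set_takeD in_set_dropD)
  have len: "length ?x < length w" using ij by simp
  from ij(4) show ?thesis
  proof
    assume "j \<le> b"
    then have "b - (j - i) \<in> {1..length ?x}" using ij w(3) by auto
    then show ?thesis using that[OF x len r(1)] r(3) \<open>j \<le> b\<close> by blast
  next
    assume "b \<le> i"
    then have "b \<in> {1..length ?x}" using ij w(3) by auto
    then show ?thesis using that[OF x len r(1)] r(2) \<open>b \<le> i\<close> by blast
  qed
qed

text \<open>Makes a guessed c checkable on finitely many words. A longer word breaking the bound
  could be cut on one side of the offending boundary, giving a shorter word that breaks it
  too.\<close>

lemma crossings_le_extends:
  assumes k: "Suc (state_bound m) ^ Suc c \<le> k" "2 * k + 1 \<le> n"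
    and short: "\<And>w s. w \<in> lists S \<Longrightarrow> length w \<le> n \<Longrightarrow> alive m w s \<Longrightarrow> crossings_le m c w s"
  shows "w \<in> lists S \<Longrightarrow> alive m w s \<Longrightarrow> crossings_le m c w s"
proof (induction "length w" arbitrary: w s rule: less_induct)
  case (less w s\<^sub>0)
  show ?case
  proof (rule ccontr)
    assume "\<not> crossings_le m c w s\<^sub>0"
    \<comment> \<open>At the first moment of failure all sequences have length at most c + 1, so
      that at most k different ones occur.\<close>
    then obtain s where s: "alive m w s" "\<not> crossings_le m c w s"
      and least: "\<And>r. alive m w r \<Longrightarrow> r < s \<Longrightarrow> crossings_le m c w r"
      using exists_least_iff[of "\<lambda>s. alive m w s \<and> \<not> crossings_le m c w s"] less.prems(2) by blast
    obtain b where b: "b \<in> {1..length w}" "length (crossings (int b) (run m w s)) > c"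
      using s(2) by (auto simp: crossings_le_def not_le)
    have "length w > n" using short less.prems(1) s by (meson not_le)
    have le: "crossings_le m (Suc c) w s"
    proof (cases s)
      case (Suc r)
      then have "crossings_le m c w r" using least[of r] s(1) by (simp add: alive_Suc)
      then show ?thesis unfolding crossings_le_def Suc
        by (meson Suc_le_mono crossings_Suc_length le_trans)
    qed (simp add: crossings_le_def)
    let ?f = "\<lambda>b. crossings (int b) (run m w s)" and ?F = "short_seqs (state_bound m) (Suc c)"
    have card: "card ?F \<le> k" using card_short_seqs[of "state_bound m" "Suc c"] k(1) by linarith
    \<comment> \<open>Since the word has more than 2 k + 1 letters, one side of b, with b included,
      has more than k boundaries.\<close>
    have "\<exists>i j. 1 \<le> i \<and> i < j \<and> j \<le> length w \<and> (j \<le> b \<or> b \<le> i) \<and> ?f i = ?f j"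
    proof (cases "k < b")
      case True
      have "?f ` {1..<b + 1} \<subseteq> ?F" using crossings_in_short_seqs[OF le] b(1) by auto
      from repetition[OF finite_short_seqs this] card True obtain i j where
        "1 \<le> i" "i < j" "j < b + 1" "?f i = ?f j" by (metis add_diff_cancel_right' le_less_trans)
      then show ?thesis using b(1) by (intro exI[of _ i] exI[of _ j]) auto
    next
      case False
      have sub: "?f ` {b..<length w + 1} \<subseteq> ?F" using crossings_in_short_seqs[OF le] b(1) by auto
      have "card ?F < length w + 1 - b" using card False \<open>length w > n\<close> k(2) by linarith
      from repetition[OF finite_short_seqs sub this] obtain i j where
        "b \<le> i" "i < j" "j < length w + 1" "?f i = ?f j" .
      then show ?thesis using b(1) by (intro exI[of _ i] exI[of _ j]) auto
    qed
    then obtain i j where ij: "1 \<le> i" "i < j" "j \<le> length w" "j \<le> b \<or> b \<le> i" "?f i = ?f j" by blast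
    obtain x r b' where x: "x \<in> lists S" "length x < length w" "alive m x r" "b' \<in> {1..length x}"
      "crossings (int b') (run m x r) = ?f b"
      using shorter_much_crossed[OF less.prems(1) s(1) b(1) ij] .
    have "crossings_le m c x r" using less.hyps x by blast
    then have "length (?f b) \<le> c" using x(4,5) unfolding crossings_le_def by metis
    then show False using b(2) by simp
  qed
qed

section \<open>The n log n lower bound at a shortest much-crossed word\<close>

lemma inj_much_crossed:
  assumes w: "w \<in> lists S" "alive m w s" "b \<in> {1..length w}"
    and least: "\<And>x r b'. x \<in> lists S \<Longrightarrow> length x < length w \<Longrightarrow> alive m x r \<Longrightarrow> b' \<in> {1..length x} \<Longrightarrow>
      length (crossings (int b') (run m x r)) < length (crossings (int b) (run m w s))"
  shows "inj_on (\<lambda>b. crossings (int b) (run m w s)) {1..b}"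
    "inj_on (\<lambda>b. crossings (int b) (run m w s)) {b..length w}"
proof -
  have "crossings (int i) (run m w s) \<noteq> crossings (int j) (run m w s)"
    if "1 \<le> i" "i < j" "j \<le> length w" "j \<le> b \<or> b \<le> i" for i j
  proof
    assume "crossings (int i) (run m w s) = crossings (int j) (run m w s)"
    from shorter_much_crossed[OF w that this] least show False by (metis nat_less_le)
  qed
  then show "inj_on (\<lambda>b. crossings (int b) (run m w s)) {1..b}"
    "inj_on (\<lambda>b. crossings (int b) (run m w s)) {b..length w}"
    using w(3) by (auto intro!: linorder_inj_onI')
qed

text \<open>By minimality no sequence repeats on either side of b, and one side has at least half of
  the boundaries. All but \<open>Suc (state_bound m) ^ l\<close> of these have more than l
  crossings, and crossings of different boundaries are different steps.\<close>

lemma time_lower_bound: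
  assumes w: "w \<in> lists S" "alive m w s" "b \<in> {1..length w}"
    and least: "\<And>x r b'. x \<in> lists S \<Longrightarrow> length x < length w \<Longrightarrow> alive m x r \<Longrightarrow> b' \<in> {1..length x} \<Longrightarrow>
      length (crossings (int b') (run m x r)) < length (crossings (int b) (run m w s))"
  shows "l * (length w div 2 - Suc (state_bound m) ^ l) \<le> s"
proof -
  let ?f = "\<lambda>b. crossings (int b) (run m w s)"
  obtain B where B: "B \<subseteq> {1..length w}" "length w div 2 \<le> card B" "inj_on ?f B"
  proof (cases "length w div 2 \<le> b")
    case True
    then show ?thesis using that[of "{1..b}"] inj_much_crossed(1)[OF w least] w(3) by auto
  next
    case False
    then show ?thesis using that[of "{b..length w}"] inj_much_crossed(2)[OF w least] w(3) by auto
  qed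
  have fin: "finite B" using B(1) finite_subset by blast
  define D where "D = {b \<in> B. length (?f b) \<le> l}"
  have "?f ` D \<subseteq> short_seqs (state_bound m) l"
    by (auto simp: D_def short_seqs_def dest!: subsetD[OF set_crossings])
  note card_mono[OF finite_short_seqs this]
  also note card_short_seqs
  also have "card (?f ` D) = card D"
    by (rule card_image) (use B(3) in \<open>auto simp: D_def intro: inj_on_subset\<close>)
  finally have "length w div 2 - Suc (state_bound m) ^ l \<le> card (B - D)"
    using B(2) fin by (subst card_Diff_subset) (auto simp: D_def)
  then have "l * (length w div 2 - Suc (state_bound m) ^ l) \<le> (\<Sum>b\<in>B - D. l)"
    by simp
  also have "\<dots> \<le> (\<Sum>b\<in>B - D. length (?f b))"
    by (rule sum_mono) (auto simp: D_def)
  also have "\<dots> \<le> (\<Sum>b\<in>B. length (?f b))"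
    using fin by (intro sum_mono2) auto
  also have "\<dots> \<le> s"
    using sum_crossings_le[OF fin, of "run m w s"] by simp
  finally show ?thesis .
qed

text \<open>With \<open>q \<le> 2\<^sup>a\<close>, the choice \<open>l \<approx> (log n - 3) / a\<close> in the bound above gives \<open>q\<^sup>l \<le> n / 8\<close>.\<close>

lemma n_log_n_lower_bound:
  fixes n q s :: nat
  assumes q: "q \<le> 2 ^ a" "1 \<le> a" and n: "2 ^ (2 * a + 8) \<le> n"
    and s: "\<And>l. l * (n div 2 - q ^ l) \<le> s"
  shows "real n * log 2 (real n) \<le> 8 * real a * real s"
proof -
  define L where "L = log 2 (real n)"
  define l where "l = nat \<lfloor>(L - 3) / a\<rfloor>"
  have "(2::nat) ^ 2 \<le> 2 ^ (2 * a + 8)" by (intro power_increasing) auto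
  then have n4: "4 \<le> n" using n by simp
  then have nL: "real n = 2 powr L" by (simp add: L_def)
  have "2 powr real (2 * a + 8) \<le> real n"
    using n by (metis of_nat_le_iff of_nat_numeral of_nat_power powr_realpow zero_less_numeral)
  \<comment> \<open>Due to this threshold, the 3 and the rounding in l cost at most half of L: 2 (L
    - 3 - a) >= L.\<close>
  then have L: "2 * real a + 8 \<le> L" unfolding nL by simp
  have l1: "real l * a \<le> L - 3"
  proof -
    have "real l \<le> (L - 3) / a" using L q(2) unfolding l_def by simp
    then show ?thesis using q(2) by (simp add: field_simps)
  qed
  have l2: "L \<le> 2 * real a * real l"
  proof -
    have "(L - 3) / a - 1 \<le> real l" unfolding l_def by linarith
    then have "L - 3 - a \<le> a * real l" using q(2) by (simp add: field_simps)
    then show ?thesis using L by simp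
  qed
  have "real (q ^ l) \<le> real ((2 ^ a) ^ l)" using q(1) by (intro of_nat_mono power_mono) auto
  also have "\<dots> = 2 powr (real l * a)" by (simp add: powr_realpow[symmetric] power_mult[symmetric] mult.commute)
  also have "\<dots> \<le> 2 powr (L - 3)" using l1 by simp
  also have "\<dots> = real n / 8" by (simp add: nL powr_diff)
  finally have ql: "real (q ^ l) \<le> real n / 8" .
  \<comment> \<open>As n >= 4, subtracting 1/2 and n/8 from n/2 leaves at least n/4.\<close>
  have "real n / 2 - 1 / 2 \<le> real (n div 2)" by linarith
  then have "real n / 4 \<le> real (n div 2) - real (q ^ l)"
    using ql n4 by linarith
  also have "\<dots> \<le> real (n div 2 - q ^ l)" by linarith
  finally have "real l * (real n / 4) \<le> real l * real (n div 2 - q ^ l)"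
    by (intro mult_left_mono) auto
  also have "\<dots> \<le> real s" using s[of l] by (metis of_nat_le_iff of_nat_mult)
  finally have "real l * real n \<le> 4 * real s" by simp
  then have "2 * real a * (real l * real n) \<le> 2 * real a * (4 * real s)"
    by (intro mult_left_mono) auto
  moreover have "L * real n \<le> 2 * real a * real l * real n"
    using l2 by (intro mult_right_mono) auto
  ultimately show ?thesis unfolding L_def by (simp add: algebra_simps)
qed

text \<open>A shortest word with a sequence longer than c meets the minimality hypothesis of
  \<open>time_lower_bound\<close>, because shorter words stay within c. If it is long, the n log n
  bound contradicts the growth hypothesis; if it is short, the choice of c excludes it.\<close>

lemma bounded_crossings:
  fixes T :: "nat \<Rightarrow> real"
  assumes pos: "\<And>n. T n > 0"
    and time: "\<And>w s. w \<in> lists S \<Longrightarrow> alive m w s \<Longrightarrow> real s \<le> T (length w)"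
    and growth: "\<And>k :: nat. \<exists>N. \<forall>n\<ge>N. real n * log 2 (real n) / T n \<ge> real k"
  obtains c where "\<And>w s. w \<in> lists S \<Longrightarrow> alive m w s \<Longrightarrow> crossings_le m c w s"
proof -
  define a where "a = Suc (state_bound m)"
  have a: "Suc (state_bound m) \<le> 2 ^ a" "1 \<le> a" unfolding a_def using less_exp[of "Suc (state_bound m)"] by simp_all
  \<comment> \<open>The lower bound has the constant 8 a, which 8 a + 1 contradicts.\<close>
  obtain N where N: "\<And>n. n \<ge> N \<Longrightarrow> real n * log 2 (real n) / T n \<ge> real (8 * a + 1)"
    using growth by blast
  define n\<^sub>0 where "n\<^sub>0 = max N (2 ^ (2 * a + 8))"
  \<comment> \<open>A sequence is no longer than the run, and runs on words of length up to
    \<open>n\<^sub>0\<close> have at most c steps.\<close>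
  define c where "c = nat \<lceil>Max (T ` {..n\<^sub>0})\<rceil>"
  define long where "long = (\<lambda>w. w \<in> lists S \<and> (\<exists>s. alive m w s \<and> \<not> crossings_le m c w s))"
  have "\<not> long w" for w
  proof
    assume "long w"
    define w\<^sub>0 where "w\<^sub>0 = arg_min length long"
    have w\<^sub>0: "long w\<^sub>0" "\<And>x. long x \<Longrightarrow> length w\<^sub>0 \<le> length x"
      unfolding w\<^sub>0_def using arg_min_nat_lemma[of long w length] \<open>long w\<close> by auto
    obtain s b where s: "w\<^sub>0 \<in> lists S" "alive m w\<^sub>0 s" "b \<in> {1..length w\<^sub>0}"
        "c < length (crossings (int b) (run m w\<^sub>0 s))"
      using w\<^sub>0(1) unfolding long_def crossings_le_def by (metis not_le)
    have "length (crossings (int b') (run m x r)) < length (crossings (int b) (run m w\<^sub>0 s))"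
      if "x \<in> lists S" "length x < length w\<^sub>0" "alive m x r" "b' \<in> {1..length x}" for x r b'
    proof -
      have "\<not> long x" using that(2) w\<^sub>0(2) by (meson not_le)
      then have "length (crossings (int b') (run m x r)) \<le> c"
        using that unfolding long_def crossings_le_def by blast
      then show ?thesis using s(4) by simp
    qed
    from time_lower_bound[OF s(1-3) this]
    have lb: "l * (length w\<^sub>0 div 2 - Suc (state_bound m) ^ l) \<le> s" for l by blast
    let ?n = "length w\<^sub>0"
    have sT: "real s \<le> T ?n" using time s by blast
    show False
    proof (cases "n\<^sub>0 \<le> ?n")
      case True
      then have "real ?n * log 2 (real ?n) \<le> 8 * real a * real s"
        using n_log_n_lower_bound[OF a _ lb] by (simp add: n\<^sub>0_def)
      also have "\<dots> \<le> 8 * real a * T ?n" using sT by (intro mult_left_mono) auto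
      finally have "real ?n * log 2 (real ?n) / T ?n \<le> 8 * real a"
        using pos[of ?n] by (simp add: field_simps)
      moreover have "real (8 * a + 1) \<le> real ?n * log 2 (real ?n) / T ?n"
        using N[of ?n] True by (simp add: n\<^sub>0_def)
      ultimately show False by simp
    next
      case False
      then have "T ?n \<le> Max (T ` {..n\<^sub>0})" by (intro Max_ge) auto
      then have "s \<le> c" using sT unfolding c_def by linarith
      moreover have "length (crossings (int b) (run m w\<^sub>0 s)) \<le> s"
        using sum_crossings_le[of "{b}" "run m w\<^sub>0 s"] by simp
      ultimately show False using s(4) by simp
    qed
  qed
  then show ?thesis using that[of c] unfolding long_def by blast
qed


section \<open>Reducing and expanding runs\<close>

text \<open>Formulated as a trial insertion into w, so that simulation on words of length
  \<open>length w + d\<close> decides it. Equal crossing sequences at both ends of y allow y to be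
  transplanted, with its share of the run, to any boundary that has this sequence.\<close>

definition period :: "nat list \<Rightarrow> nat set \<Rightarrow> nat list \<Rightarrow> nat \<Rightarrow> nat \<Rightarrow> nat \<Rightarrow> bool" where
  "period m S w s d \<tau> \<longleftrightarrow> (\<exists>i\<in>{1..length w}. \<exists>y. y \<in> lists S \<and> length y = d \<and>
     (let x = take i w @ y @ drop i w; L = run m x (s + \<tau>)
      in alive m x (s + \<tau>) \<and> crossings (int i) L = crossings (int i) (run m w s) \<and>
         crossings (int (i + d)) L = crossings (int i) (run m w s) \<and>
         visits (int i) (int (i + d)) L = \<tau>))"

text \<open>The survival of all crossing sequences of w in \<open>w\<^sub>0\<close> carries the
  induction: every piece that was cut out still finds a boundary of the base word where it fits. The
  length bound is the one from \<open>redundant_interval\<close>.\<close>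

lemma reduce_run:
  assumes k: "Suc (state_bound m) ^ c \<le> k"
  shows "w \<in> lists S \<Longrightarrow> alive m w s \<Longrightarrow> crossings_le m c w s \<Longrightarrow>
    \<exists>w\<^sub>0 s\<^sub>0 ps. w\<^sub>0 \<in> lists S \<and> length w\<^sub>0 \<le> (k + 1) * (k + 1) \<and> alive m w\<^sub>0 s\<^sub>0 \<and>
      (\<forall>b\<in>{1..length w}. \<exists>b'\<in>{1..length w\<^sub>0}. crossings (int b') (run m w\<^sub>0 s\<^sub>0) = crossings (int b) (run m w s)) \<and>
      length w = length w\<^sub>0 + sum_list (map fst ps) \<and> s = s\<^sub>0 + sum_list (map snd ps) \<and>
      (\<forall>(d, \<tau>)\<in>set ps. 1 \<le> d \<and> d \<le> k \<and> period m S w\<^sub>0 s\<^sub>0 d \<tau>)"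
proof (induction "length w" arbitrary: w s rule: less_induct)
  case less
  show ?case
  proof (cases "length w \<le> (k + 1) * (k + 1)")
    case True
    then show ?thesis using less.prems by (intro exI[of _ w] exI[of _ s] exI[of _ "[]"]) auto
  next
    case False
    let ?f = "\<lambda>b. crossings (int b) (run m w s)"
    have F: "?f ` {1..length w} \<subseteq> short_seqs (state_bound m) c"
      using crossings_in_short_seqs[OF less.prems(3)] by auto
    have "card (short_seqs (state_bound m) c) \<le> k" using card_short_seqs k le_trans by blast
    from redundant_interval[OF finite_short_seqs F this] False
    obtain i j where ij: "1 \<le> i" "i < j" "j \<le> length w" "j - i \<le> k" "?f i = ?f j"
      and red: "\<And>b. b \<in> {i<..j} \<Longrightarrow> \<exists>b'\<in>{1..length w} - {i<..j}. ?f b' = ?f b"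
      by (metis nat_le_linear)
    define x where "x = take i w @ drop j w"
    define \<tau> where "\<tau> = visits (int i) (int j) (run m w s)"
    obtain r where r: "alive m x r" "s = r + \<tau>"
      "\<And>b :: nat. b \<le> i \<Longrightarrow> crossings b (run m x r) = ?f b"
      "\<And>b :: nat. j \<le> b \<Longrightarrow> crossings (int (b - (j - i))) (run m x r) = ?f b"
      using cut_cycle[OF ij(1-3) less.prems(2) ij(5)] unfolding x_def \<tau>_def by metis
    have lx: "length x = length w - (j - i)" using ij by (simp add: x_def)
    have x: "x \<in> lists S" using less.prems(1) by (auto simp: x_def dest: in_set_takeD in_set_dropD)
    have "length (crossings (int b) (run m x r)) \<le> c" if "b \<in> {1..length x}" for b
    proof (cases "b \<le> i")
      case True
      then show ?thesis using r(3) that ij less.prems(3) by (simp add: crossings_le_def)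
    next
      case False
      then have "crossings (int b) (run m x r) = ?f (b + (j - i))" using r(4)[of "b + (j - i)"] ij by simp
      moreover have "b + (j - i) \<in> {1..length w}" using that ij lx by auto
      ultimately show ?thesis using less.prems(3) unfolding crossings_le_def by metis
    qed
    then have "crossings_le m c x r" by (simp add: crossings_le_def)
    moreover have "length x < length w" using ij lx by simp
    ultimately obtain w\<^sub>0 s\<^sub>0 ps where
      w\<^sub>0: "w\<^sub>0 \<in> lists S" "length w\<^sub>0 \<le> (k + 1) * (k + 1)" "alive m w\<^sub>0 s\<^sub>0"
      and cr: "\<And>b. b \<in> {1..length x} \<Longrightarrow> \<exists>b'\<in>{1..length w\<^sub>0}. crossings (int b') (run m w\<^sub>0 s\<^sub>0) = crossings (int b) (run m x r)"
      and len: "length x = length w\<^sub>0 + sum_list (map fst ps)" "r = s\<^sub>0 + sum_list (map snd ps)"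
      and ps: "\<forall>(d, \<tau>)\<in>set ps. 1 \<le> d \<and> d \<le> k \<and> period m S w\<^sub>0 s\<^sub>0 d \<tau>"
      using less.hyps[OF _ x r(1)] by blast
    have out: "\<exists>b'\<in>{1..length w\<^sub>0}. crossings (int b') (run m w\<^sub>0 s\<^sub>0) = ?f b"
      if "b \<in> {1..length w} - {i<..j}" for b
    proof (cases "b \<le> i")
      case True
      then show ?thesis using cr[of b] r(3)[of b] that ij lx by auto
    next
      case False
      then have "j \<le> b" using that by auto
      moreover from this have "b - (j - i) \<in> {1..length x}" using that ij lx by auto
      ultimately show ?thesis using cr[of "b - (j - i)"] r(4)[of b] by auto
    qed
    \<comment> \<open>The piece between i and j is tried at a boundary of the base word that has the
      crossing sequence of i.\<close>
    have "period m S w\<^sub>0 s\<^sub>0 (j - i) \<tau>"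
    proof -
      obtain b where b: "b \<in> {1..length w\<^sub>0}" "crossings (int b) (run m w\<^sub>0 s\<^sub>0) = ?f i"
        using out[of i] ij by auto
      note ins = insert_cycle[of b w\<^sub>0 i j w m s\<^sub>0 s]
      let ?y = "take (j - i) (drop i w)"
      have "?y \<in> lists S" using less.prems(1) by (auto dest: in_set_takeD in_set_dropD)
      moreover have "length ?y = j - i" using ij by simp
      ultimately show ?thesis
        unfolding period_def Let_def
        using ins(1,2) ins(3)[of b] ins(4)[of b] b w\<^sub>0 less.prems(2) ij
        by (intro bexI[of _ b] exI[of _ ?y]) (auto simp: \<tau>_def)
    qed
    moreover have "\<exists>b'\<in>{1..length w\<^sub>0}. crossings (int b') (run m w\<^sub>0 s\<^sub>0) = ?f b" if "b \<in> {1..length w}" for b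
    proof (cases "b \<in> {i<..j}")
      case True then show ?thesis using red out by metis
    qed (use that out in auto)
    moreover have "length w = length w\<^sub>0 + sum_list (map fst ((j - i, \<tau>) # ps))" using len lx ij by simp
    moreover have "s = s\<^sub>0 + sum_list (map snd ((j - i, \<tau>) # ps))" using len r(2) by simp
    ultimately show ?thesis using w\<^sub>0 ps ij
      by (intro exI[of _ w\<^sub>0] exI[of _ s\<^sub>0] exI[of _ "(j - i, \<tau>) # ps"]) auto
  qed
qed

text \<open>Each piece is taken from its trial insertion into \<open>w\<^sub>0\<close> and put into
  the growing word. No crossing sequence of \<open>w\<^sub>0\<close> is lost on the way, so there is
  always a place for the next piece, whatever was inserted before.\<close>

lemma expand_run:
  assumes w\<^sub>0: "w\<^sub>0 \<in> lists S" "alive m w\<^sub>0 s\<^sub>0"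
  shows "\<forall>(d, \<tau>)\<in>set ps. period m S w\<^sub>0 s\<^sub>0 d \<tau> \<Longrightarrow>
    \<exists>w s. w \<in> lists S \<and> alive m w s \<and> length w = length w\<^sub>0 + sum_list (map fst ps) \<and>
      s = s\<^sub>0 + sum_list (map snd ps) \<and>
      (\<forall>b\<in>{1..length w\<^sub>0}. \<exists>b'\<in>{1..length w}. crossings (int b') (run m w s) = crossings (int b) (run m w\<^sub>0 s\<^sub>0))"
proof (induction ps)
  case Nil
  then show ?case using w\<^sub>0 by auto
next
  case (Cons p ps)
  obtain d \<tau> where p: "p = (d, \<tau>)" by fastforce
  have "\<forall>(d, \<tau>)\<in>set ps. period m S w\<^sub>0 s\<^sub>0 d \<tau>" using Cons.prems by simp
  from Cons.IH[OF this] obtain w s where w: "w \<in> lists S" "alive m w s" "length w = length w\<^sub>0 + sum_list (map fst ps)"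
      "s = s\<^sub>0 + sum_list (map snd ps)"
    and cr: "\<And>b. b \<in> {1..length w\<^sub>0} \<Longrightarrow> \<exists>b'\<in>{1..length w}. crossings (int b') (run m w s) = crossings (int b) (run m w\<^sub>0 s\<^sub>0)"
    by blast
  have "period m S w\<^sub>0 s\<^sub>0 d \<tau>" using Cons.prems p by simp
  then obtain i y where iy: "i \<in> {1..length w\<^sub>0}" "y \<in> lists S" "length y = d"
    and v: "alive m (take i w\<^sub>0 @ y @ drop i w\<^sub>0) (s\<^sub>0 + \<tau>)"
      "crossings (int i) (run m (take i w\<^sub>0 @ y @ drop i w\<^sub>0) (s\<^sub>0 + \<tau>)) = crossings (int i) (run m w\<^sub>0 s\<^sub>0)"
      "crossings (int (i + d)) (run m (take i w\<^sub>0 @ y @ drop i w\<^sub>0) (s\<^sub>0 + \<tau>)) = crossings (int i) (run m w\<^sub>0 s\<^sub>0)"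
      "visits (int i) (int (i + d)) (run m (take i w\<^sub>0 @ y @ drop i w\<^sub>0) (s\<^sub>0 + \<tau>)) = \<tau>"
    unfolding period_def Let_def by blast
  obtain i' where i': "i' \<in> {1..length w}" "crossings (int i') (run m w s) = crossings (int i) (run m w\<^sub>0 s\<^sub>0)"
    using cr iy(1) by blast
  let ?x = "take i' w @ y @ drop i' w"
  have y: "take (i + d - i) (drop i (take i w\<^sub>0 @ y @ drop i w\<^sub>0)) = y" using iy by simp
  note ins = insert_cycle[of i' w i "i + d" "take i w\<^sub>0 @ y @ drop i w\<^sub>0" m s "s\<^sub>0 + \<tau>", unfolded y v(4)]
  have pre: "1 \<le> i'" "i' \<le> length w" "1 \<le> i" "i \<le> i + d" "i + d \<le> length (take i w\<^sub>0 @ y @ drop i w\<^sub>0)"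
    using i' iy by auto
  note pre = pre w(2) v(1)
  have al: "alive m ?x (s + \<tau>)" using ins(1)[OF pre] v i'(2) by simp
  have cr': "\<exists>b'\<in>{1..length ?x}. crossings (int b') (run m ?x (s + \<tau>)) = crossings (int b) (run m w s)"
    if "b \<in> {1..length w}" for b
  proof (cases "b \<le> i'")
    case True
    then show ?thesis using ins(3)[OF pre, of b] v i' that by (intro bexI[of _ b]) auto
  next
    case False
    then show ?thesis using ins(4)[OF pre, of b] v i' that iy(3) by (intro bexI[of _ "b + d"]) auto
  qed
  have "\<exists>b'\<in>{1..length ?x}. crossings (int b') (run m ?x (s + \<tau>)) = crossings (int b) (run m w\<^sub>0 s\<^sub>0)"
    if "b \<in> {1..length w\<^sub>0}" for b
    using cr[OF that] cr' by metis
  moreover have "?x \<in> lists S" using w(1) iy(2) by (auto dest: in_set_takeD in_set_dropD)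
  moreover have "length ?x = length w\<^sub>0 + sum_list (map fst (p # ps))" using w(3) i' iy(3) p by simp
  moreover have "s + \<tau> = s\<^sub>0 + sum_list (map snd (p # ps))" using w(4) p by simp
  ultimately show ?case using al by blast
qed


section \<open>Effective simulation\<close>

lemma eff_head_pos [eff_intros]:
  assumes "eff L" shows "eff (\<lambda>x. head_pos (L x))"
  unfolding head_pos_def by (intro eff_intros assms[THEN eff_compose])

lemma eff_head_state [eff_intros]:
  assumes "eff m" "eff L" shows "eff (\<lambda>x. head_state (m x) (L x))"
  unfolding head_state_def by (intro eff_intros assms[THEN eff_compose])

lemma eff_initial_content [eff_intros]:
  assumes "eff m" "eff w" "eff p" shows "eff (\<lambda>x. initial_content (m x) (w x) (p x))"
  unfolding initial_content_def by (intro eff_intros assms[THEN eff_compose])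

lemma eff_content [eff_intros]:
  assumes "eff m" "eff w" "eff p" "eff L" shows "eff (\<lambda>x. content (m x) (w x) (p x) (L x))"
  unfolding content_def by (intro eff_intros assms[THEN eff_compose])

lemma eff_table_entry [eff_intros]:
  assumes "eff m" "eff q" "eff a" shows "eff (\<lambda>x. table_entry (m x) (q x) (a x))"
  unfolding table_entry_def by (intro eff_intros assms[THEN eff_compose])

lemma eff_next_event [eff_intros]:
  assumes "eff m" "eff w" "eff L" shows "eff (\<lambda>x. next_event (m x) (w x) (L x))"
  unfolding next_event_def by (intro eff_intros assms[THEN eff_compose])

lemma eff_run [eff_intros]:
  assumes "eff m" "eff w" "eff s" shows "eff (\<lambda>x. run (m x) (w x) (s x))"
proof -
  have "run m w s = rec_nat [] (\<lambda>_ L. next_event m w L # L) s" for m w s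
    by (induction s) auto
  moreover have "eff (\<lambda>x. rec_nat [] (\<lambda>_ L. next_event (m x) (w x) L # L) (s x))"
    by (intro eff_intros assms[THEN eff_compose])
  ultimately show ?thesis by simp
qed

lemma dec_halted [eff_intros]:
  assumes "eff m" "eff q" shows "dec (\<lambda>x. halted (m x) (q x))"
  unfolding halted_def by (intro eff_intros assms[THEN eff_compose])

lemma dec_alive [eff_intros]:
  assumes "eff m" "eff w" "eff s" shows "dec (\<lambda>x. alive (m x) (w x) (s x))"
  unfolding alive_def by (intro eff_intros assms[THEN eff_compose])

lemma dec_crosses [eff_intros]:
  assumes "eff b" "eff e" shows "dec (\<lambda>x. crosses (b x) (e x))"
  unfolding crosses_def by (intro eff_intros assms[THEN eff_compose])

lemma eff_crossings [eff_intros]: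
  assumes "eff b" "eff L" shows "eff (\<lambda>x. crossings (b x) (L x))"
  unfolding crossings_def by (intro eff_intros assms[THEN eff_compose])

lemma eff_visits [eff_intros]:
  assumes "eff i" "eff j" "eff L" shows "eff (\<lambda>x. visits (int (i x)) (int (j x)) (L x))"
  unfolding visits_def by (intro eff_intros assms[THEN eff_compose])

lemma eff_state_bound [eff_intros]:
  assumes "eff m" shows "eff (\<lambda>x. state_bound (m x))"
  unfolding state_bound_def by (intro eff_intros assms[THEN eff_compose])

lemma dec_crossings_le [eff_intros]:
  assumes "eff m" "eff c" "eff w" "eff s" shows "dec (\<lambda>x. crossings_le (m x) (c x) (w x) (s x))"
proof -
  have "crossings_le m c w s \<longleftrightarrow> (\<forall>b\<in>set [1..<Suc (length w)]. length (crossings (int b) (run m w s)) \<le> c)" for m c w s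
    by (auto simp: crossings_le_def)
  moreover have "dec (\<lambda>x. \<forall>b\<in>set [1..<Suc (length (w x))]. length (crossings (int b) (run (m x) (w x) (s x))) \<le> c x)"
    by (intro eff_intros assms[THEN eff_compose])
  ultimately show ?thesis by simp
qed

section \<open>Enumeration of words and test of periods\<close>

definition alphabet :: "nat list \<Rightarrow> nat list" where
  "alphabet m = filter (\<lambda>a. odd (entry m 2 div 2 ^ a)) [0..<entry m 1]"

lemma eff_alphabet [eff_intros]:
  assumes "eff m" shows "eff (\<lambda>x. alphabet (m x))"
  unfolding alphabet_def by (intro eff_intros assms[THEN eff_compose])

primrec words :: "nat list \<Rightarrow> nat \<Rightarrow> nat list list" where
  "words S 0 = [[]]"
| "words S (Suc n) = concat (map (\<lambda>w. map (\<lambda>a. a # w) S) (words S n))"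

lemma set_words: "set (words S n) = {w \<in> lists (set S). length w = n}"
proof (induction n)
  case (Suc n)
  then show ?case by (auto simp: length_Suc_conv image_iff)
qed auto

lemma eff_words [eff_intros]:
  assumes "eff S" "eff n" shows "eff (\<lambda>x. words (S x) (n x))"
proof -
  have "words S n = rec_nat [[]] (\<lambda>_ W. concat (map (\<lambda>w. map (\<lambda>a. a # w) S) W)) n" for S n
    by (induction n) auto
  moreover have "eff (\<lambda>x. rec_nat [[]] (\<lambda>_ W. concat (map (\<lambda>w. map (\<lambda>a. a # w) (S x)) W)) (n x))"
    by (intro eff_intros assms[THEN eff_compose])
  ultimately show ?thesis by simp
qed

lemma dec_period [eff_intros]:
  assumes "eff m" "eff S" "eff w" "eff s" "eff d" "eff \<tau>"
  shows "dec (\<lambda>x. period (m x) (set (S x)) (w x) (s x) (d x) (\<tau> x))"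
proof -
  have "period m (set S) w s d \<tau> \<longleftrightarrow> (\<exists>i\<in>set [1..<Suc (length w)]. \<exists>y\<in>set (words S d).
     alive m (take i w @ y @ drop i w) (s + \<tau>) \<and>
     crossings (int i) (run m (take i w @ y @ drop i w) (s + \<tau>)) = crossings (int i) (run m w s) \<and>
     crossings (int (i + d)) (run m (take i w @ y @ drop i w) (s + \<tau>)) = crossings (int i) (run m w s) \<and>
     visits (int i) (int (i + d)) (run m (take i w @ y @ drop i w) (s + \<tau>)) = \<tau>)" for m S w s d \<tau>
    unfolding set_words set_upt atLeastLessThanSuc_atLeastAtMost period_def Let_def by blast
  moreover have "dec (\<lambda>x. \<exists>i\<in>set [1..<Suc (length (w x))]. \<exists>y\<in>set (words (S x) (d x)).
     alive (m x) (take i (w x) @ y @ drop i (w x)) (s x + \<tau> x) \<and>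
     crossings (int i) (run (m x) (take i (w x) @ y @ drop i (w x)) (s x + \<tau> x)) = crossings (int i) (run (m x) (w x) (s x)) \<and>
     crossings (int (i + d x)) (run (m x) (take i (w x) @ y @ drop i (w x)) (s x + \<tau> x)) = crossings (int i) (run (m x) (w x) (s x)) \<and>
     visits (int i) (int (i + d x)) (run (m x) (take i (w x) @ y @ drop i (w x)) (s x + \<tau> x)) = \<tau> x)"
    by (intro eff_intros assms[THEN eff_compose])
  ultimately show ?thesis by simp
qed


section \<open>Linear sets of lengths and times\<close>

lemma affine_Cons: "affine (a # l) x = a + (\<Sum>i<length l. x (Suc i) * l ! i)"
proof -
  have "(\<Sum>i\<in>{1..<Suc (length l)}. x i * (a # l) ! i) = (\<Sum>i<length l. x (Suc i) * (a # l) ! Suc i)"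
    unfolding One_nat_def sum.shift_bounds_Suc_ivl lessThan_atLeast0 ..
  then show ?thesis by (simp add: affine_def)
qed

lemma affine_Cons_upd:
  assumes "i < length l"
  shows "affine (a # l) (x(Suc i := Suc (x (Suc i)))) = affine (a # l) x + l ! i"
  unfolding affine_Cons using assms by (simp add: sum.remove[of "{..<length l}" i])

text \<open>The coefficients are multiplicities in qs. Should ps contain repetitions, any index of q
  may be raised.\<close>

lemma affine_attained:
  "set qs \<subseteq> set ps \<Longrightarrow> \<exists>x. affine (a # map fst ps) x = a + sum_list (map fst qs) \<and>
     affine (b # map snd ps) x = b + sum_list (map snd qs)"
proof (induction qs)
  case Nil
  then show ?case by (intro exI[of _ "\<lambda>_. 0"]) (simp add: affine_Cons)
next
  case (Cons q qs)
  then obtain x where x: "affine (a # map fst ps) x = a + sum_list (map fst qs)"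
    "affine (b # map snd ps) x = b + sum_list (map snd qs)" by auto
  obtain i where i: "i < length ps" "ps ! i = q" using Cons.prems by (auto simp: in_set_conv_nth)
  show ?case
    using i x by (intro exI[of _ "x(Suc i := Suc (x (Suc i)))"]) (simp add: affine_Cons_upd del: fun_upd_apply)
qed

lemma affine_decompose:
  obtains qs where "set qs \<subseteq> set ps" "affine (a # map fst ps) x = a + sum_list (map fst qs)"
    "affine (b # map snd ps) x = b + sum_list (map snd qs)"
proof
  let ?qs = "concat (map (\<lambda>i. replicate (x (Suc i)) (ps ! i)) [0..<length ps])"
  show "set ?qs \<subseteq> set ps" by auto
  have eq: "sum_list (map f (concat (map g xs))) = sum_list (map (\<lambda>i. sum_list (map f (g i))) xs)"
    for f :: "nat \<times> nat \<Rightarrow> nat" and g and xs :: "nat list"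
    by (induction xs) auto
  have "sum_list (map f ?qs) = (\<Sum>i<length ps. x (Suc i) * f (ps ! i))" for f :: "nat \<times> nat \<Rightarrow> nat"
    unfolding eq by (simp add: sum_list_replicate interv_sum_list_conv_sum_set_nat lessThan_atLeast0)
  then show "affine (a # map fst ps) x = a + sum_list (map fst ?qs)"
    "affine (b # map snd ps) x = b + sum_list (map snd ?qs)"
    by (simp_all add: affine_Cons)
qed


section \<open>The two searches\<close>

text \<open>In the following, \<open>h\<close> decides the instances of manageability, and \<open>t\<close> is the integral part of the
  bound for the empty word, which no instance covers because the lengths in an instance are positive.\<close>

definition within_bound :: "(nat \<Rightarrow> nat) \<Rightarrow> nat \<Rightarrow> nat list \<Rightarrow> nat \<Rightarrow> (nat \<times> nat) list \<Rightarrow> bool" where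
  "within_bound h t w s ps \<longleftrightarrow>
     (if w = [] then s \<le> t else h (lists_encode (length w # map fst ps, s # map snd ps)) = 0)"

definition violation :: "(nat \<Rightarrow> nat) \<Rightarrow> nat \<Rightarrow> nat list \<Rightarrow> nat list \<Rightarrow> nat \<Rightarrow> bool" where
  "violation h t m w s \<longleftrightarrow> (\<forall>a\<in>set w. a \<in> set (alphabet m)) \<and> alive m w s \<and> \<not> within_bound h t w s []"

definition periods :: "nat list \<Rightarrow> nat list \<Rightarrow> nat \<Rightarrow> nat \<Rightarrow> nat \<Rightarrow> (nat \<times> nat) list" where
  "periods m w s k r = filter (\<lambda>p. period m (set (alphabet m)) w s (fst p) (snd p))
     (concat (map (\<lambda>d. map (\<lambda>\<tau>. (d, \<tau>)) [0..<r]) [1..<Suc k]))"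

text \<open>Bounds the number of crossing sequences of length at most c + 1; the extra 1 is for the
  moment at which c is first exceeded.\<close>

definition seq_bound :: "nat list \<Rightarrow> nat \<Rightarrow> nat" where
  "seq_bound m c = Suc (state_bound m) ^ Suc c"

text \<open>With k for \<open>seq_bound m c\<close>, this is room for a base word of
  \<open>reduce_run\<close> and one inserted period of length at most k. It also exceeds the 2 k + 1
  required by \<open>crossings_le_extends\<close>.\<close>

definition word_bound :: "nat list \<Rightarrow> nat \<Rightarrow> nat" where
  "word_bound m c = (seq_bound m c + 1) * (seq_bound m c + 1) + seq_bound m c"

text \<open>The number r makes this a finite check: no run on a short word reaches r steps, so all
  truncated runs on such words are inspected.\<close>

definition certificate :: "(nat \<Rightarrow> nat) \<Rightarrow> nat \<Rightarrow> nat list \<Rightarrow> nat \<Rightarrow> nat \<Rightarrow> bool" where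
  "certificate h t m c r \<longleftrightarrow> (\<forall>n<Suc (word_bound m c). \<forall>w\<in>set (words (alphabet m) n). \<not> alive m w r \<and>
     (\<forall>s<r. alive m w s \<longrightarrow> crossings_le m c w s \<and> within_bound h t w s (periods m w s (seq_bound m c) r)))"

lemma dec_within_bound [eff_intros]:
  assumes "computable h" "eff w" "eff s" "eff ps"
  shows "dec (\<lambda>x. within_bound h t (w x) (s x) (ps x))"
  unfolding within_bound_def lists_encode_def prod.case
  by (intro eff_intros eff_computable[OF assms(1)] assms(2-)[THEN eff_compose])

lemma dec_violation [eff_intros]:
  assumes "computable h" "eff m" "eff w" "eff s"
  shows "dec (\<lambda>x. violation h t (m x) (w x) (s x))"
  unfolding violation_def by (intro eff_intros assms(1) assms(2-)[THEN eff_compose])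

lemma eff_periods [eff_intros]:
  assumes "eff m" "eff w" "eff s" "eff k" "eff r"
  shows "eff (\<lambda>x. periods (m x) (w x) (s x) (k x) (r x))"
  unfolding periods_def by (intro eff_intros assms[THEN eff_compose])

lemma dec_certificate [eff_intros]:
  assumes "computable h" "eff m" "eff c" "eff r"
  shows "dec (\<lambda>x. certificate h t (m x) (c x) (r x))"
  unfolding certificate_def word_bound_def seq_bound_def
  by (intro eff_intros assms(1) assms(2-)[THEN eff_compose])

lemma set_periods:
  "set (periods m w s k r) = {(d, \<tau>). 1 \<le> d \<and> d \<le> k \<and> \<tau> < r \<and> period m (set (alphabet m)) w s d \<tau>}"
  by (auto simp: periods_def)

section \<open>Soundness, completeness and termination of the searches\<close>

locale time_bound =
  fixes T :: "nat \<Rightarrow> real" and h :: "nat \<Rightarrow> nat" and t :: nat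
  assumes pos: "T n > 0"
    and decides: "(A, B) \<in> manageable_instances \<Longrightarrow>
      h (lists_encode (A, B)) = (if \<exists>x. T (affine A x) < real (affine B x) then 1 else 0)"
    and zero: "t = nat \<lfloor>T 0\<rfloor>"
begin

lemma within_bound_iff:
  assumes "\<forall>(d, \<tau>)\<in>set ps. 1 \<le> d"
  shows "within_bound h t w s ps \<longleftrightarrow> (if w = [] then real s \<le> T 0 else
    (\<forall>x. real (affine (s # map snd ps) x) \<le> T (affine (length w # map fst ps) x)))"
proof (cases "w = []")
  case True
  have "s \<le> t \<longleftrightarrow> real s \<le> T 0"
    using pos[of 0] unfolding zero by (simp add: le_nat_iff le_floor_iff)
  then show ?thesis using True by (simp add: within_bound_def)
next
  case False
  have "(length w # map fst ps, s # map snd ps) \<in> manageable_instances"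
    using assms False by (auto simp: manageable_instances_def)
  moreover have "(\<exists>x. T (affine (length w # map fst ps) x) < real (affine (s # map snd ps) x)) \<longleftrightarrow>
      \<not> (\<forall>x. real (affine (s # map snd ps) x) \<le> T (affine (length w # map fst ps) x))"
    by (simp add: not_le)
  ultimately show ?thesis using False decides by (simp add: within_bound_def)
qed

lemma within_bound_Nil_iff: "within_bound h t w s [] \<longleftrightarrow> real s \<le> T (length w)"
  by (cases "w = []") (simp_all add: within_bound_iff affine_Cons)

lemma violation_iff:
  "violation h t m w s \<longleftrightarrow> w \<in> lists (set (alphabet m)) \<and> alive m w s \<and> \<not> real s \<le> T (length w)"
  unfolding violation_def within_bound_Nil_iff by auto

text \<open>The crossing bound extends from short words to w, which makes w reducible to a short
  base run. Its length and time then form a point of a linear set that the certificate has compared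
  with T.\<close>

lemma certificate_sound:
  assumes cert: "certificate h t m c r" and w: "w \<in> lists (set (alphabet m))" "alive m w s"
  shows "real s \<le> T (length w)"
proof -
  let ?S = "set (alphabet m)" and ?k = "seq_bound m c"
  have short: "\<not> alive m v r \<and> (\<forall>s<r. alive m v s \<longrightarrow> crossings_le m c v s \<and> within_bound h t v s (periods m v s ?k r))"
    if "v \<in> lists ?S" "length v \<le> word_bound m c" for v
    using cert that unfolding certificate_def set_words less_Suc_eq_le mem_Collect_eq by blast
  have less: "s < r" if "v \<in> lists ?S" "length v \<le> word_bound m c" "alive m v s" for v s
    using short[OF that(1,2)] alive_mono[OF that(3)] by (meson not_le)
  have "crossings_le m c w s"
  proof (rule crossings_le_extends[OF _ _ _ w])
    show "Suc (state_bound m) ^ Suc c \<le> ?k" by (simp add: seq_bound_def)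
    show "2 * ?k + 1 \<le> word_bound m c" by (simp add: word_bound_def)
    show "crossings_le m c v s" if "v \<in> lists ?S" "length v \<le> word_bound m c" "alive m v s" for v s
      using short less that by blast
  qed
  moreover have k: "Suc (state_bound m) ^ c \<le> ?k" by (simp add: seq_bound_def)
  ultimately obtain w\<^sub>0 s\<^sub>0 ps where
    w\<^sub>0: "w\<^sub>0 \<in> lists ?S" "length w\<^sub>0 \<le> (?k + 1) * (?k + 1)" "alive m w\<^sub>0 s\<^sub>0"
    and cr: "\<forall>b\<in>{1..length w}. \<exists>b'\<in>{1..length w\<^sub>0}. crossings (int b') (run m w\<^sub>0 s\<^sub>0) = crossings (int b) (run m w s)"
    and len: "length w = length w\<^sub>0 + sum_list (map fst ps)" "s = s\<^sub>0 + sum_list (map snd ps)"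
    and ps: "\<forall>(d, \<tau>)\<in>set ps. 1 \<le> d \<and> d \<le> ?k \<and> period m ?S w\<^sub>0 s\<^sub>0 d \<tau>"
    using reduce_run[OF k w] by blast
  have bound: "length w\<^sub>0 \<le> word_bound m c" using w\<^sub>0(2) by (simp add: word_bound_def)
  let ?ps = "periods m w\<^sub>0 s\<^sub>0 ?k r"
  have within_bound: "within_bound h t w\<^sub>0 s\<^sub>0 ?ps"
    using short[OF w\<^sub>0(1) bound] less[OF w\<^sub>0(1) bound w\<^sub>0(3)] w\<^sub>0(3) by blast
  have sub: "set ps \<subseteq> set ?ps"
  proof
    fix p assume "p \<in> set ps"
    moreover obtain d \<tau> where p: "p = (d, \<tau>)" by fastforce
    ultimately have d: "1 \<le> d" "d \<le> ?k" "period m ?S w\<^sub>0 s\<^sub>0 d \<tau>" using ps by auto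
    then obtain i y where iy: "i \<in> {1..length w\<^sub>0}" "y \<in> lists ?S" "length y = d"
      "alive m (take i w\<^sub>0 @ y @ drop i w\<^sub>0) (s\<^sub>0 + \<tau>)"
      unfolding period_def Let_def by blast
    let ?x = "take i w\<^sub>0 @ y @ drop i w\<^sub>0"
    have "?x \<in> lists ?S" using iy(2) w\<^sub>0(1) by (auto dest: in_set_takeD in_set_dropD)
    moreover have "length ?x \<le> word_bound m c" using iy d(2) w\<^sub>0(2) by (simp add: word_bound_def)
    \<comment> \<open>The trial insertion is itself a run on a short word; this brings \<tau> into
      the range that \<open>periods\<close> searches.\<close>
    ultimately have "s\<^sub>0 + \<tau> < r" using less iy(4) by blast
    then show "p \<in> set ?ps" using d p by (simp add: set_periods)
  qed
  show ?thesis
  proof (cases "w\<^sub>0 = []")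
    case True
    \<comment> \<open>An empty base word has no boundary to carry the crossing sequences of w, so w
      has none either. This justifies that \<open>within_bound\<close> ignores periods of the empty
      word.\<close>
    then have "w = []" using cr by (cases w) auto
    then have "sum_list (map fst ps) = 0" using len(1) by simp
    then have "ps = []" using ps by (cases ps) auto
    then show ?thesis using within_bound True \<open>w = []\<close> len within_bound_iff[of ?ps w\<^sub>0 s\<^sub>0] by (auto simp: set_periods)
  next
    case False
    obtain x where "affine (length w\<^sub>0 # map fst ?ps) x = length w" "affine (s\<^sub>0 # map snd ?ps) x = s"
      using affine_attained[OF sub, of "length w\<^sub>0" s\<^sub>0] len by auto
    moreover have "real (affine (s\<^sub>0 # map snd ?ps) x) \<le> T (affine (length w\<^sub>0 # map fst ?ps) x)"
      using within_bound False within_bound_iff[of ?ps w\<^sub>0 s\<^sub>0] by (auto simp: set_periods)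
    ultimately show ?thesis by simp
  qed
qed

text \<open>By \<open>expand_run\<close> every point of the linear sets is the length and time of an
  actual run, so no comparison can fail for a machine that obeys T.\<close>

lemma certificate_exists:
  assumes growth: "\<And>k :: nat. \<exists>N. \<forall>n\<ge>N. real n * log 2 (real n) / T n \<ge> real k"
    and time: "\<And>w s. w \<in> lists (set (alphabet m)) \<Longrightarrow> alive m w s \<Longrightarrow> real s \<le> T (length w)"
  obtains c r where "certificate h t m c r"
proof -
  let ?S = "set (alphabet m)"
  obtain c where c: "\<And>w s. w \<in> lists ?S \<Longrightarrow> alive m w s \<Longrightarrow> crossings_le m c w s"
    using bounded_crossings[OF pos time growth] by blast
  define r where "r = Suc (nat \<lceil>Max (T ` {..word_bound m c})\<rceil>)"
  have "\<not> alive m w r" if "w \<in> lists ?S" "length w \<le> word_bound m c" for w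
  proof
    assume "alive m w r"
    then have "real r \<le> T (length w)" using time that by blast
    also have "\<dots> \<le> Max (T ` {..word_bound m c})" using that by (intro Max_ge) auto
    finally show False unfolding r_def by linarith
  qed
  moreover have "within_bound h t w s (periods m w s (seq_bound m c) r)" if w: "w \<in> lists ?S" "alive m w s" for w s
  proof -
    let ?ps = "periods m w s (seq_bound m c) r"
    have "real (affine (s # map snd ?ps) x) \<le> T (affine (length w # map fst ?ps) x)" for x
    proof -
      obtain qs where qs: "set qs \<subseteq> set ?ps"
        "affine (length w # map fst ?ps) x = length w + sum_list (map fst qs)"
        "affine (s # map snd ?ps) x = s + sum_list (map snd qs)"
        using affine_decompose[where ps = ?ps and x = x and a = "length w" and b = s] by metis
      then have "\<forall>(d, \<tau>)\<in>set qs. period m ?S w s d \<tau>" by (auto simp: set_periods)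
      from expand_run[OF w this] show ?thesis using time qs by metis
    qed
    then show ?thesis using time[OF w] within_bound_iff[of ?ps w s] by (auto simp: set_periods)
  qed
  ultimately have "certificate h t m c r"
    unfolding certificate_def set_words using c by auto
  then show ?thesis by (rule that)
qed

text \<open>A single number carries a candidate for each alternative, so one minimisation does both
  searches. Whether the number found holds a certificate is then the answer.\<close>

lemma decidable_alive_bound:
  assumes "computable h"
    and growth: "\<And>k :: nat. \<exists>N. \<forall>n\<ge>N. real n * log 2 (real n) / T n \<ge> real k"
  obtains f where "computable f" "\<And>m. f (list_encode m) =
    (if \<forall>w s. w \<in> lists (set (alphabet m)) \<longrightarrow> alive m w s \<longrightarrow> real s \<le> T (length w) then 1 else 0)"
proof -
  define yes where "yes = (\<lambda>m y. let z = decode y :: (nat \<times> nat) \<times> nat list \<times> nat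
    in certificate h t m (fst (fst z)) (snd (fst z)))"
  define no where "no = (\<lambda>m y. let z = decode y :: (nat \<times> nat) \<times> nat list \<times> nat
    in violation h t m (fst (snd z)) (snd (snd z)))"
  define good where "good = (\<lambda>m. \<forall>w s. w \<in> lists (set (alphabet m)) \<longrightarrow> alive m w s \<longrightarrow> real s \<le> T (length w))"
  have yes: "good m" if "yes m y" for m y
    using that certificate_sound unfolding yes_def good_def Let_def by blast
  have no: "\<not> good m" if "no m y" for m y
    using that unfolding no_def good_def Let_def violation_iff by blast
  \<comment> \<open>Minimisation demands a witness for every m, whether or not m codes a
    machine.\<close>
  have ex: "\<exists>y. yes m y \<or> no m y" for m
  proof (cases "good m")
    case True
    then obtain c r where "certificate h t m c r"
      using certificate_exists[OF growth] unfolding good_def by blast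
    then have "yes m (code ((c, r), ([] :: nat list), 0 :: nat))" unfolding yes_def Let_def decode_code by simp
    then show ?thesis by blast
  next
    case False
    then obtain w s where "violation h t m w s" unfolding good_def violation_iff by blast
    then have "no m (code ((0 :: nat, 0 :: nat), w, s))" unfolding no_def Let_def decode_code by simp
    then show ?thesis by blast
  qed
  define y where "y = (\<lambda>m. LEAST y. yes m y \<or> no m y)"
  have dec_yes: "dec (\<lambda>x. yes (f x) (g x))" if "eff f" "eff g" for f and g :: "'a :: encodable \<Rightarrow> nat"
    unfolding yes_def Let_def by (intro eff_intros assms(1) eff_decode that)
  have dec_no: "dec (\<lambda>x. no (f x) (g x))" if "eff f" "eff g" for f and g :: "'a :: encodable \<Rightarrow> nat"
    unfolding no_def Let_def by (intro eff_intros assms(1) eff_decode that)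
  have y: "eff y"
    unfolding y_def by (intro eff_Least ex eff_intros dec_yes dec_no)
  have "dec (\<lambda>n. yes (list_decode n) (y (list_decode n)))"
    by (intro dec_yes eff_intros eff_compose[OF y])
  then have "computable (\<lambda>n. of_bool (yes (list_decode n) (y (list_decode n))))"
    by (simp add: dec_def eff_def)
  moreover have "yes m (y m) \<longleftrightarrow> good m" for m
    using LeastI_ex[OF ex[of m]] yes no unfolding y_def by blast
  ultimately show ?thesis
    using that[of "\<lambda>n. of_bool (yes (list_decode n) (y (list_decode n)))"] unfolding good_def by simp
qed

end


section \<open>Turing machines as coded machines\<close>

definition tm_list :: "tm \<Rightarrow> nat list" where
  "tm_list M = [num_states M, num_symbols M, set_encode (input_alphabet M), blank M,
      list_encode (trans_table M), start M, accept M, reject M]"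

lemma entry_tm_list [simp]:
  "entry (tm_list M) 1 = num_symbols M" "entry (tm_list M) (Suc 0) = num_symbols M"
  "entry (tm_list M) 2 = set_encode (input_alphabet M)" "entry (tm_list M) 3 = blank M"
  "entry (tm_list M) 4 = list_encode (trans_table M)" "entry (tm_list M) 5 = start M"
  "entry (tm_list M) 6 = accept M" "entry (tm_list M) 7 = reject M"
  by (simp_all add: tm_list_def entry_def)

lemma halted_tm_list [simp]: "halted (tm_list M) q \<longleftrightarrow> halting M q"
  by (simp add: halted_def halting_def)

lemma set_alphabet_tm_list:
  assumes "one_tape_tm M" shows "set (alphabet (tm_list M)) = input_alphabet M"
proof -
  have sub: "input_alphabet M \<subseteq> {..<num_symbols M}" using assms by (auto simp: one_tape_tm_def)
  then have "set_decode (set_encode (input_alphabet M)) = input_alphabet M"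
    by (intro set_encode_inverse) (auto intro: finite_subset)
  then have "a \<in> input_alphabet M \<longleftrightarrow> odd (set_encode (input_alphabet M) div 2 ^ a)" for a
    by (metis mem_Collect_eq set_decode_def)
  then show ?thesis using sub by (auto simp: alphabet_def)
qed

lemma concat_map_upt_nth:
  assumes "q < n" "a < k"
  shows "length (concat (map (\<lambda>q. map (g q) [0..<k]) [0..<n])) = n * k"
    "concat (map (\<lambda>q. map (g q) [0..<k]) [0..<n]) ! (q * k + a) = g q a"
proof -
  have len: "length (concat (map (\<lambda>q. map (g q) [0..<k]) [0..<n])) = n * k" for n
    by (induction n) auto
  show "length (concat (map (\<lambda>q. map (g q) [0..<k]) [0..<n])) = n * k" by (rule len)
  show "concat (map (\<lambda>q. map (g q) [0..<k]) [0..<n]) ! (q * k + a) = g q a"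
    using assms(1)
  proof (induction n)
    case (Suc n)
    show ?case
    proof (cases "q < n")
      case True
      have "q * k + a < Suc q * k" using assms(2) by simp
      also have "\<dots> \<le> n * k" using True by (intro mult_right_mono) auto
      finally show ?thesis using Suc True by (simp add: nth_append len)
    next
      case False
      then have "q = n" using Suc.prems by simp
      then show ?thesis using assms(2) by (simp add: nth_append len)
    qed
  qed simp
qed

lemma table_entry_tm_list:
  assumes "q < num_states M" "a < num_symbols M"
  shows "table_entry (tm_list M) q a =
    (case trans M q a of (q', b, d) \<Rightarrow> (q', prod_encode (b, move_encode d)))"
proof -
  have "q * num_symbols M + a < Suc q * num_symbols M" using assms(2) by simp
  also have "\<dots> \<le> num_states M * num_symbols M" using assms(1) by (intro mult_right_mono) auto
  finally have "q * num_symbols M + a < length (trans_table M)"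
    unfolding trans_table_def concat_map_upt_nth(1)[OF assms] .
  then show ?thesis
    unfolding table_entry_def entry_tm_list list_encode_inverse
    by (simp add: entry_nth) (simp add: trans_table_def concat_map_upt_nth(2)[OF assms] split: prod.split)
qed

section \<open>Simulation of the step relation\<close>

definition config_of :: "tm \<Rightarrow> nat list \<Rightarrow> event list \<Rightarrow> config" where
  "config_of M w L = (head_state (tm_list M) L, (\<lambda>p. content (tm_list M) w p L), head_pos L)"

lemma content_Cons: "content m w p (e # L) = (if src e = p then written e else content m w p L)"
  by (simp add: content_def)

lemma step_config_of:
  assumes "head_state (tm_list M) L < num_states M" "content (tm_list M) w (head_pos L) L < num_symbols M"
  shows "step M (config_of M w L) c \<longleftrightarrow>
    \<not> halting M (head_state (tm_list M) L) \<and> c = config_of M w (next_event (tm_list M) w L # L)"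
proof -
  obtain q' b d where tr: "trans M (head_state (tm_list M) L) (content (tm_list M) w (head_pos L) L) = (q', b, d)"
    by (metis prod_cases3)
  have e: "next_event (tm_list M) w L = (head_pos L, head_pos L + shift d, q', b)"
    using table_entry_tm_list[OF assms] tr by (cases d) (simp_all add: next_event_def Let_def)
  show ?thesis
    by (auto simp: step_def config_of_def e tr content_Cons fun_eq_iff)
qed

text \<open>The table is read correctly only at states and symbols in range. At halting states
  \<open>trans\<close> may leave the range, so the invariant is restricted to genuine steps.\<close>

lemma alive_in_range:
  assumes M: "one_tape_tm M" and w: "w \<in> lists (input_alphabet M)"
  shows "alive (tm_list M) w s \<Longrightarrow> head_state (tm_list M) (run (tm_list M) w s) < num_states M \<and>
    (\<forall>p. content (tm_list M) w p (run (tm_list M) w s) < num_symbols M)"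
proof (induction s)
  case 0
  have "initial_content (tm_list M) w p < num_symbols M" for p
  proof (cases "0 \<le> p \<and> nat p < length w")
    case True
    then have "w ! nat p \<in> input_alphabet M" using w by auto
    then show ?thesis using True M by (auto simp: initial_content_def entry_nth one_tape_tm_def)
  next
    case False
    then show ?thesis using M by (auto simp: initial_content_def one_tape_tm_def)
  qed
  then show ?case using M by (simp add: one_tape_tm_def content_def)
next
  case (Suc s)
  let ?L = "run (tm_list M) w s"
  let ?q = "head_state (tm_list M) ?L" and ?a = "content (tm_list M) w (head_pos ?L) ?L"
  have al: "alive (tm_list M) w s" "\<not> halting M ?q" using Suc.prems by (simp_all add: alive_Suc)
  then have r: "?q < num_states M" "\<And>p. content (tm_list M) w p ?L < num_symbols M" using Suc.IH by blast+
  obtain q' b d where tr: "trans M ?q ?a = (q', b, d)" by (metis prod_cases3)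
  have "\<And>q a. q < num_states M \<Longrightarrow> a < num_symbols M \<Longrightarrow> \<not> halting M q \<Longrightarrow>
      (case trans M q a of (q', b, d) \<Rightarrow> q' < num_states M \<and> b < num_symbols M)"
    using M by (simp add: one_tape_tm_def)
  from this[OF r(1) r(2)[of "head_pos ?L"] al(2)] tr have "q' < num_states M" "b < num_symbols M" by simp_all
  moreover have "new_state (next_event (tm_list M) w ?L) = q'" "written (next_event (tm_list M) w ?L) = b"
    using table_entry_tm_list[OF r(1) r(2)[of "head_pos ?L"]] tr by (simp_all add: next_event_def Let_def)
  ultimately show ?case using r by (simp add: content_Cons)
qed

text \<open>\<open>step\<close> has no successor at a halting state while \<open>run\<close>
  continues; \<open>alive\<close> cuts the run off at the same point.\<close>

lemma steps_iff:
  assumes M: "one_tape_tm M" and w: "w \<in> lists (input_alphabet M)"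
  shows "(step M ^^ s) (initial M w) c \<longleftrightarrow>
    alive (tm_list M) w s \<and> c = config_of M w (run (tm_list M) w s)"
proof (induction s arbitrary: c)
  case 0
  have "initial M w = config_of M w []"
    by (auto simp: initial_def config_of_def content_def initial_content_def entry_nth fun_eq_iff)
  then show ?case by auto
next
  case (Suc s)
  have "(step M ^^ Suc s) (initial M w) c \<longleftrightarrow>
      alive (tm_list M) w s \<and> step M (config_of M w (run (tm_list M) w s)) c"
    using Suc by (auto simp: relcompp_apply)
  also have "\<dots> \<longleftrightarrow> alive (tm_list M) w (Suc s) \<and> c = config_of M w (run (tm_list M) w (Suc s))"
  proof (cases "alive (tm_list M) w s")
    case True
    with alive_in_range[OF M w, of s]
    have r: "head_state (tm_list M) (run (tm_list M) w s) < num_states M"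
      "content (tm_list M) w (head_pos (run (tm_list M) w s)) (run (tm_list M) w s) < num_symbols M"
      by blast+
    show ?thesis unfolding step_config_of[OF r] by (simp add: True alive_Suc)
  qed (simp add: alive_Suc)
  finally show ?case .
qed

lemma runs_in_time_iff:
  assumes "one_tape_tm M"
  shows "runs_in_time M T \<longleftrightarrow> (\<forall>w s. w \<in> lists (set (alphabet (tm_list M))) \<longrightarrow>
    alive (tm_list M) w s \<longrightarrow> real s \<le> T (length w))"
  unfolding runs_in_time_def set_alphabet_tm_list[OF assms] using steps_iff[OF assms] by blast

theorem theorem4p7:
  fixes T :: "nat \<Rightarrow> real"
  assumes "\<And>n. T n > 0"
    and "manageable T"
    and "computably_converges_to_infinity (\<lambda>n. real n * log 2 (real n) / T n)"
  shows "decidable_on tm_encode {M. one_tape_tm M} (\<lambda>M. runs_in_time M T)"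
proof -
  obtain h where h: "computable h" "\<And>A B. (A, B) \<in> manageable_instances \<Longrightarrow>
      h (lists_encode (A, B)) = (if \<exists>x. T (affine A x) < real (affine B x) then 1 else 0)"
    using assms(2) unfolding manageable_def decidable_on_def by fastforce
  interpret time_bound T h "nat \<lfloor>T 0\<rfloor>"
    by standard (use assms(1) h(2) in auto)
  have "\<exists>N. \<forall>n\<ge>N. real n * log 2 (real n) / T n \<ge> real k" for k
    using assms(3) unfolding computably_converges_to_infinity_def by blast
  then obtain f where f: "computable f" "\<And>m. f (list_encode m) =
    (if \<forall>w s. w \<in> lists (set (alphabet m)) \<longrightarrow> alive m w s \<longrightarrow> real s \<le> T (length w) then 1 else 0)"
    using decidable_alive_bound[OF h(1)] by blast
  have "f (tm_encode M) = (if runs_in_time M T then 1 else 0)" if "one_tape_tm M" for M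
    using f(2)[of "tm_list M"] unfolding runs_in_time_iff[OF that] by (simp add: tm_list_def tm_encode_def)
  then show ?thesis unfolding decidable_on_def using f(1) by blast
qed

end
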